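(* For every $k\geq 2$, $\tau^P_{2k}\geq \frac{1}{2}$ and $\tau^P_{2k+1}\geq\frac{2}{5}$.
   Context: For a pure simplicial complex $\Delta$, $T(\Delta)$ is the minimum size of a set of vertices meeting every facet, and $\tau(\Delta)=T(\Delta)/f_0(\Delta)$ where $f_0(\Delta)$ is the number of vertices. For $d\ge2$, $$\tau^P_d=\limsup_{n\to\infty}\max\{\tau(\partial Q): Q \text{ a simplicial } d\text{-polytope with } n \text{ vertices}\},$$ where $\partial Q$ is the boundary complex of $Q$ (vertex sets of proper faces). *)

theory Defs
  imports "HOL-Analysis.Analysis" "HOL-Library.Liminf_Limsup" "HOL-Library.Extended_Real"
begin

text \<open>Complexes are given by their family of faces, each face being a finite set of vertices;
  the empty face may belong to the family.\<close>

definition facets :: "'v set set \<Rightarrow> 'v set set" where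
  "facets \<Delta> = {F \<in> \<Delta>. \<forall>G\<in>\<Delta>. F \<subseteq> G \<longrightarrow> G = F}"

definition f0 :: "'v set set \<Rightarrow> nat" where
  "f0 \<Delta> = card (\<Union>\<Delta>)"

definition transversal :: "'v set set \<Rightarrow> 'v set \<Rightarrow> bool" where
  "transversal \<Delta> S \<longleftrightarrow> S \<subseteq> \<Union>\<Delta> \<and> (\<forall>F\<in>facets \<Delta>. S \<inter> F \<noteq> {})"

definition transversal_number :: "'v set set \<Rightarrow> nat" where
  "transversal_number \<Delta> = (LEAST m. \<exists>S. finite S \<and> transversal \<Delta> S \<and> card S = m)"

definition transversal_ratio :: "'v set set \<Rightarrow> real" where
  "transversal_ratio \<Delta> = real (transversal_number \<Delta>) / real (f0 \<Delta>)"

definition vertices :: "'a::real_vector set \<Rightarrow> 'a set" where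
  "vertices Q = {v. v extreme_point_of Q}"

definition boundary_complex :: "'a::real_vector set \<Rightarrow> 'a set set" where
  "boundary_complex Q = {vertices F |F. F face_of Q \<and> F \<noteq> Q}"

text \<open>The empty face is the simplex of dimension \<open>-1\<close>. The polytope need not be
  full-dimensional in the ambient space.\<close>

definition simplicial_polytope :: "nat \<Rightarrow> 'a::euclidean_space set \<Rightarrow> bool" where
  "simplicial_polytope d Q \<longleftrightarrow> polytope Q \<and> aff_dim Q = int d \<and>
     (\<forall>F. F face_of Q \<and> F \<noteq> Q \<longrightarrow> (\<exists>m. m simplex F))"

text \<open>Since HOL cannot quantify over types inside a formula, the ambient space of the polytopes
  is a parameter; its choice is immaterial as long as its dimension is at least \<open>d\<close>.
  The maximum is over a finite set, which is nonempty exactly if \<open>n > d\<close> (when \<open>d \<ge> 2\<close>);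
  the finitely many unspecified values for \<open>n \<le> d\<close> do not affect the upper limit.\<close>

definition tau_P :: "'a::euclidean_space itself \<Rightarrow> nat \<Rightarrow> ereal" where
  "tau_P _ d = limsup (\<lambda>n. ereal (Max {transversal_ratio (boundary_complex Q) |Q :: 'a set.
     simplicial_polytope d Q \<and> card (vertices Q) = n}))"

end

theory Submission
  imports Defs "HOL-Real_Asymp.Real_Asymp"
begin

text \<open>In even dimension \<open>2k\<close> take cyclic polytopes: by Gale's evenness condition a transversal leaves
  fewer than \<open>k\<close> of the pairs \<open>{2i, 2i + 1}\<close> untouched.

  In dimension \<open>2k + 1\<close> take points \<open>(t, \<dots>, t\<^sup>2\<^sup>k, z)\<close>, where the parameters \<open>t\<close> come in tiny blocks of five
  around the integers. Near a double root a polynomial is a parabola, so a hyperplane touching at \<open>k\<close> blocks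
  can contain a lower edge of \<open>(t, t\<^sup>2)\<close> in \<open>k - 1\<close> of them and a lower facet of \<open>(t, t\<^sup>2, z)\<close> in the
  remaining one, provided the latter block is much smaller than the others. The heights \<open>z\<close> are
  chosen such that no point of a block lies in all these lower facets. So a transversal contains at least two
  points of all but at most \<open>k - 1\<close> blocks.\<close>

section \<open>Transversal ratios and the upper limit\<close>

lemma vertices_face:
  assumes "F face_of Q"
  shows "vertices F = vertices Q \<inter> F"
  using extreme_point_of_face[OF assms] by (auto simp: vertices_def)

lemma boundary_complex_Union_subset: "\<Union>(boundary_complex Q) \<subseteq> vertices Q"
  unfolding boundary_complex_def using vertices_face by blast

text \<open>The \<open>LEAST\<close> is attained only if a transversal exists. A nonempty facet
  \<open>D\<close> prevents the empty set from being a facet, so all vertices together form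
  one.\<close>

lemma transversal_number_ge:
  assumes "finite (\<Union>\<Delta>)" "D \<in> facets \<Delta>" "D \<noteq> {}"
    and "\<And>S. finite S \<Longrightarrow> transversal \<Delta> S \<Longrightarrow> m \<le> card S"
  shows "m \<le> transversal_number \<Delta>"
proof -
  have "transversal \<Delta> (\<Union>\<Delta>)"
    using assms(2,3) by (fastforce simp: transversal_def facets_def)
  then have "\<exists>m S. finite S \<and> transversal \<Delta> S \<and> card S = m"
    using assms(1) by blast
  then have "\<exists>S. finite S \<and> transversal \<Delta> S \<and> card S = transversal_number \<Delta>"
    unfolding transversal_number_def by (rule LeastI_ex)
  then show ?thesis using assms(4) by metis
qed

text \<open>\<open>Max\<close> is meaningful only over a finite set. There are infinitely many
  polytopes, but numerator and denominator of the ratio take finitely many values once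
  \<open>n\<close> is fixed.\<close>

lemma finite_transversal_ratios:
  "finite {transversal_ratio (boundary_complex Q) |Q :: 'a::euclidean_space set.
     simplicial_polytope d Q \<and> card (vertices Q) = n}" (is "finite ?R")
proof -
  \<comment> \<open>The default value of \<open>LEAST\<close>, taken when no transversal
    exists.\<close>
  let ?L = "LEAST m::nat. False"
  let ?N = "insert ?L {..n}"
  have "?R \<subseteq> (\<lambda>(a, b). real a / real b) ` (?N \<times> {..n})"
  proof
    fix x assume "x \<in> ?R"
    then obtain Q :: "'a set" where Q: "x = transversal_ratio (boundary_complex Q)"
      "simplicial_polytope d Q" "card (vertices Q) = n" by auto
    let ?D = "boundary_complex Q"
    have "finite (vertices Q)"
      using Q(2) finite_polyhedron_extreme_points polytope_imp_polyhedron
      unfolding vertices_def simplicial_polytope_def by blast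
    then have fin: "finite (\<Union>?D)" and card: "card (\<Union>?D) \<le> n"
      using boundary_complex_Union_subset[of Q] Q(3) by (auto intro: finite_subset card_mono)
    have "transversal_number ?D \<in> ?N"
    proof (cases "\<exists>m S. finite S \<and> transversal ?D S \<and> card S = m")
      case True
      then have "\<exists>S. finite S \<and> transversal ?D S \<and> card S = transversal_number ?D"
        unfolding transversal_number_def by (rule LeastI_ex)
      then have "transversal_number ?D \<le> card (\<Union>?D)"
        using fin by (metis card_mono transversal_def)
      then show ?thesis using card by simp
    next
      case False
      then have "(\<lambda>m. \<exists>S. finite S \<and> transversal ?D S \<and> card S = m) = (\<lambda>m. False)" by blast
      then show ?thesis unfolding transversal_number_def by simp
    qed
    then show "x \<in> (\<lambda>(a, b). real a / real b) ` (?N \<times> {..n})"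
      using card unfolding Q(1) transversal_ratio_def f0_def by force
  qed
  then show ?thesis by (rule finite_subset) auto
qed

text \<open>An upper limit dominates the one along a subsequence, so polytopes with
  \<open>n i\<close> vertices suffice.\<close>

lemma tau_P_ge:
  fixes L :: real
  assumes n: "strict_mono n" and r: "r \<longlonglongrightarrow> L"
    and Q: "\<And>i. i \<ge> l \<Longrightarrow> \<exists>Q :: 'a::euclidean_space set. simplicial_polytope d Q \<and> card (vertices Q) = n i \<and>
              r i \<le> transversal_ratio (boundary_complex Q)"
  shows "ereal L \<le> tau_P TYPE('a) d"
proof -
  let ?R = "\<lambda>n. {transversal_ratio (boundary_complex Q) |Q :: 'a set.
     simplicial_polytope d Q \<and> card (vertices Q) = n}"
  let ?a = "\<lambda>n. ereal (Max (?R n))"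
  have "r i \<le> Max (?R (n i))" if "i \<ge> l" for i
  proof -
    obtain Q :: "'a set" where "simplicial_polytope d Q" "card (vertices Q) = n i"
      "r i \<le> transversal_ratio (boundary_complex Q)"
      using Q[OF \<open>i \<ge> l\<close>] by blast
    then show ?thesis
      by (intro order.trans[OF _ Max_ge[OF finite_transversal_ratios]]) auto
  qed
  then have "eventually (\<lambda>i. ereal (r i) \<le> (?a \<circ> n) i) sequentially"
    unfolding eventually_sequentially by auto
  then have "limsup (\<lambda>i. ereal (r i)) \<le> limsup (?a \<circ> n)"
    by (rule Limsup_mono)
  also have "\<dots> \<le> limsup ?a"
    by (rule limsup_subseq_mono[OF n])
  finally have "limsup (\<lambda>i. ereal (r i)) \<le> tau_P TYPE('a) d"
    unfolding tau_P_def .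
  moreover have "limsup (\<lambda>i. ereal (r i)) = ereal L"
    using r by (intro lim_imp_Limsup) auto
  ultimately show ?thesis by simp
qed

section \<open>Polytopes on points in general position\<close>

text \<open>\<open>U\<close> allows an ambient space of dimension above \<open>d\<close>; with
  normals \<open>a\<close> taken from \<open>U\<close>, the assumption \<open>gp\<close> speaks of
  the hyperplanes within \<open>U\<close>.\<close>

locale general_position =
  fixes P U :: "'a::euclidean_space set" and d :: nat
  assumes finite: "finite P" and subspace: "subspace U" and sub: "P \<subseteq> U"
    and dim: "dim U = d" and card: "d < card P"
    and gp: "\<And>a b. a \<in> U \<Longrightarrow> a \<noteq> 0 \<Longrightarrow> card {p \<in> P. a \<bullet> p = b} \<le> d"
    and extreme: "P \<subseteq> vertices (convex hull P)"
begin

lemma aff_dim_le: "C \<subseteq> P \<Longrightarrow> aff_dim C \<le> int d"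
  using sub aff_dim_subset[of C U] aff_dim_subspace[OF subspace] dim by auto

text \<open>Otherwise the direction space of \<open>C\<close> is a proper subspace of
  \<open>U\<close>, and a normal to it inside \<open>U\<close> gives a hyperplane that violates
  \<open>gp\<close>.\<close>

lemma aff_dim_eq:
  assumes "C \<subseteq> P" "card C = d + 1"
  shows "aff_dim C = int d"
proof (rule ccontr)
  assume "aff_dim C \<noteq> int d"
  then have lt: "aff_dim C < int d"
    using aff_dim_le[OF assms(1)] by simp
  have "C \<noteq> {}" using assms(2) by auto
  then obtain p0 where p0: "p0 \<in> C" by blast
  let ?S = "(\<lambda>x. x - p0) ` C"
  have "dim ?S < d"
    using lt aff_dim_eq_dim_subtract[OF hull_inc[OF p0]] by simp
  moreover have "?S \<subseteq> U"
    using assms(1) sub p0 subspace by (auto intro: subspace_diff)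
  then have "span ?S \<subseteq> U" using subspace by (simp add: span_minimal)
  ultimately have "span ?S \<subset> span U"
    using dim subspace by (metis dim_span less_irrefl psubsetI span_eq_iff)
  from orthogonal_to_subspace_exists_gen[OF this]
  obtain a where a: "a \<noteq> 0" "a \<in> span U" "\<And>y. y \<in> span ?S \<Longrightarrow> orthogonal a y" by blast
  have "a \<bullet> p = a \<bullet> p0" if "p \<in> C" for p
    using a(3)[of "p - p0"] that
    by (auto simp: orthogonal_def inner_diff_right span_base)
  then have "C \<subseteq> {p \<in> P. a \<bullet> p = a \<bullet> p0}" using assms(1) by auto
  then have "d + 1 \<le> card {p \<in> P. a \<bullet> p = a \<bullet> p0}"
    using assms(2) finite card_mono[of "{p \<in> P. a \<bullet> p = a \<bullet> p0}" C] by simp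
  then show False using gp[of a "a \<bullet> p0"] a(1,2) subspace by (simp add: span_eq_iff[THEN iffD2])
qed

lemma independent:
  assumes "C \<subseteq> P" "card C \<le> d + 1"
  shows "\<not> affine_dependent C"
proof -
  obtain B where B: "C \<subseteq> B" "B \<subseteq> P" "card B = d + 1"
    using exists_subset_between[of C "d + 1" P] assms card finite by auto
  have "finite B" using B finite finite_subset by blast
  then have "\<not> affine_dependent B"
    using aff_dim_eq[OF B(2,3)] B(3) by (simp add: affine_independent_iff_card)
  then show ?thesis using B(1) affine_independent_subset by blast
qed

lemma vertices_hull: "vertices (convex hull P) = P"
  using extreme extreme_point_of_convex_hull by (auto simp: vertices_def)

lemma aff_dim_hull: "aff_dim (convex hull P) = int d"
proof -
  obtain C where "C \<subseteq> P" "card C = d + 1"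
    using obtain_subset_with_card_n[of "d + 1" P] card by (metis Suc_eq_plus1 Suc_leI)
  then have "int d \<le> aff_dim P" using aff_dim_eq aff_dim_subset by metis
  then show ?thesis using aff_dim_le[of P] by (simp add: aff_dim_convex_hull)
qed

text \<open>A face with \<open>d + 1\<close> vertices would have dimension \<open>d\<close>, too
  much for a proper face; and at most \<open>d\<close> points in general position are affinely
  independent.\<close>

lemma proper_face:
  assumes F: "F face_of convex hull P" "F \<noteq> convex hull P"
  shows "card (vertices F) \<le> d" and "\<exists>m. m simplex F"
proof -
  have sub: "vertices F \<subseteq> P"
    using vertices_face[OF F(1)] vertices_hull by auto
  have comp: "compact F" "convex F"
    using F(1) finite face_of_imp_compact[of "convex hull P" F] face_of_imp_convex
    by (auto simp: finite_imp_compact_convex_hull)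
  have hull: "F = convex hull (vertices F)"
    unfolding vertices_def using Krein_Milman_Minkowski[OF comp] .
  show le: "card (vertices F) \<le> d"
  proof (rule ccontr)
    assume "\<not> card (vertices F) \<le> d"
    then obtain C where C: "C \<subseteq> vertices F" "card C = d + 1"
      using obtain_subset_with_card_n[of "d + 1" "vertices F"] by (metis Suc_eq_plus1 not_less_eq_eq)
    then have "int d \<le> aff_dim F"
      using aff_dim_eq[of C] sub hull aff_dim_subset[OF C(1)] aff_dim_convex_hull[of "vertices F"] by auto
    moreover have "aff_dim F < aff_dim (convex hull P)"
      using F by (intro face_of_aff_dim_lt) auto
    ultimately show False using aff_dim_hull by simp
  qed
  show "\<exists>m. m simplex F"
    \<comment> \<open>The dimension is an integer, so that the empty face gets
      \<open>-1\<close>.\<close>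
    unfolding simplex_def
    using hull independent[OF sub] le
    by (intro exI[of _ "int (card (vertices F)) - 1"] exI[of _ "vertices F"]) auto
qed

lemma simplicial_polytope: "simplicial_polytope d (convex hull P)"
  unfolding simplicial_polytope_def polytope_def
  using finite aff_dim_hull proper_face(2) by blast

text \<open>The supporting hyperplane cuts out a face with vertex set \<open>D\<close>, and a larger
  proper face would have more than \<open>d\<close> vertices.\<close>

lemma facetI:
  assumes D: "D \<subseteq> P" "card D = d"
    and a: "\<And>p. p \<in> P \<Longrightarrow> a \<bullet> p \<ge> b" "\<And>p. p \<in> P \<Longrightarrow> a \<bullet> p = b \<longleftrightarrow> p \<in> D"
  shows "D \<in> facets (boundary_complex (convex hull P))"
proof -
  let ?Q = "convex hull P"
  let ?F = "?Q \<inter> {x. a \<bullet> x = b}"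
  have "?Q \<subseteq> {x. a \<bullet> x \<ge> b}"
    using a(1) by (intro hull_minimal) (auto simp: convex_halfspace_ge)
  then have F: "?F face_of ?Q"
    by (intro face_of_Int_supporting_hyperplane_ge) auto
  have vF: "vertices ?F = D"
    using vertices_face[OF F] vertices_hull a(2) D(1) hull_subset[of P convex] by auto
  have ne: "?F \<noteq> ?Q"
  proof
    assume "?F = ?Q"
    then have "D = P" using vF vertices_hull by simp
    then show False using D card by simp
  qed
  have "G = D" if G: "G \<in> boundary_complex ?Q" "D \<subseteq> G" for G
  proof -
    obtain F' where F': "G = vertices F'" "F' face_of ?Q" "F' \<noteq> ?Q"
      using G by (auto simp: boundary_complex_def)
    have "finite G"
      using F' vertices_face[OF F'(2)] vertices_hull finite by auto
    then show ?thesis using proper_face(1)[OF F'(2,3)] G(2) F'(1) D(2)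
      by (metis card_seteq)
  qed
  moreover have "D \<in> boundary_complex ?Q"
    using F ne vF unfolding boundary_complex_def by blast
  ultimately show ?thesis unfolding facets_def by auto
qed

lemma transversal_ratio_ge:
  assumes m: "m > 0" and avoid: "\<And>S. S \<subseteq> P \<Longrightarrow> card S < m \<Longrightarrow>
      \<exists>D\<in>facets (boundary_complex (convex hull P)). D \<inter> S = {} \<and> D \<noteq> {}"
  shows "real m / real (card P) \<le> transversal_ratio (boundary_complex (convex hull P))"
proof -
  let ?\<Delta> = "boundary_complex (convex hull P)"
  \<comment> \<open>As \<open>m > 0\<close>, \<open>avoid\<close> applies to the empty set and
    yields a nonempty facet.\<close>
  obtain D where D: "D \<in> facets ?\<Delta>" "D \<noteq> {}"
    using avoid[of "{}"] m by auto
  have sub: "\<Union>?\<Delta> \<subseteq> P"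
    using boundary_complex_Union_subset vertices_hull by metis
  then have fin: "finite (\<Union>?\<Delta>)" using finite finite_subset by blast
  have "m \<le> transversal_number ?\<Delta>"
  proof (rule transversal_number_ge[OF fin D])
    fix S assume "finite S" "transversal ?\<Delta> S"
    then have "S \<subseteq> P" "\<forall>F\<in>facets ?\<Delta>. S \<inter> F \<noteq> {}"
      using sub by (auto simp: transversal_def)
    then show "m \<le> card S"
      using avoid[of S] by (metis Int_commute not_le)
  qed
  moreover have "0 < f0 ?\<Delta>" "f0 ?\<Delta> \<le> card P"
    using D sub fin finite by (auto simp: f0_def card_gt_0_iff facets_def intro: card_mono)
  ultimately show ?thesis
    unfolding transversal_ratio_def by (intro frac_le) auto
qed

end

text \<open>The point with index \<open>j\<close> has the coordinates \<open>u 0 j, \<dots>, u (d - 1) j\<close>, so that the functions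
  \<open>g c0 c\<close> are the affine functionals.\<close>

lemma exists_simplicial_polytope:
  fixes d :: nat and J :: "'j set" and u :: "nat \<Rightarrow> 'j \<Rightarrow> real"
  defines "g \<equiv> \<lambda>c0 c j. c0 + (\<Sum>i<d. c i * u i j)"
  assumes J: "finite J" and dim: "d \<le> DIM('a::euclidean_space)" and d: "0 < d" "d < card J" and m: "m > 0"
    and gp: "\<And>c0 c. \<exists>i<d. c i \<noteq> 0 \<Longrightarrow> card {j \<in> J. g c0 c j = 0} \<le> d"
    and ext: "\<And>j. j \<in> J \<Longrightarrow> \<exists>c0 c. g c0 c j = 0 \<and> (\<forall>j'\<in>J - {j}. g c0 c j' > 0)"
    and avoid: "\<And>S. S \<subseteq> J \<Longrightarrow> card S < m \<Longrightarrow> \<exists>D\<subseteq>J. card D = d \<and> D \<inter> S = {} \<and>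
      (\<exists>c0 c. (\<forall>j\<in>D. g c0 c j = 0) \<and> (\<forall>j\<in>J - D. g c0 c j > 0))"
  shows "\<exists>Q :: 'a set. simplicial_polytope d Q \<and> card (vertices Q) = card J \<and>
    real m / real (card J) \<le> transversal_ratio (boundary_complex Q)"
proof -
  \<comment> \<open>The coordinates are laid out along \<open>d\<close> of the basis vectors of the
    ambient space.\<close>
  obtain B :: "'a set" where B: "B \<subseteq> Basis" "card B = d" "finite B"
    using obtain_subset_with_card_n[OF dim] by auto
  obtain b where b: "bij_betw b {..<d} B"
    using ex_bij_betw_nat_finite[OF B(3)] B(2) by (auto simp: atLeast0LessThan)
  define \<phi> where "\<phi> j = (\<Sum>i<d. u i j *\<^sub>R b i)" for j
  let ?U = "span B"
  have bB: "b i \<in> B" if "i < d" for i using b that by (auto simp: bij_betw_def)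
  have bb: "b i \<bullet> b i' = (if i = i' then 1 else 0)" if "i < d" "i' < d" for i i'
    using bB[OF that(1)] bB[OF that(2)] B(1) b that
    by (auto simp: inner_Basis bij_betw_def inj_on_def subset_iff)
  have inner: "a \<bullet> \<phi> j = (\<Sum>i<d. (a \<bullet> b i) * u i j)" for a j
    by (simp add: \<phi>_def inner_sum_right mult.commute)
  have func: "\<exists>a. \<forall>j. a \<bullet> \<phi> j = (\<Sum>i<d. c i * u i j)" for c
  proof (intro exI allI)
    fix j
    have "(\<Sum>i<d. c i *\<^sub>R b i) \<bullet> b i' = c i'" if "i' < d" for i'
      using that by (simp add: inner_sum_left bb if_distrib cong: if_cong)
    then show "(\<Sum>i<d. c i *\<^sub>R b i) \<bullet> \<phi> j = (\<Sum>i<d. c i * u i j)"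
      unfolding inner by simp
  qed
  \<comment> \<open>The functional given by \<open>ext\<close> for \<open>j\<close> vanishes only
    there, so it separates \<open>j\<close> from all other indices.\<close>
  have inj: "inj_on \<phi> J"
  proof (rule inj_onI, rule ccontr)
    fix j j' assume j: "j \<in> J" "j' \<in> J" "\<phi> j = \<phi> j'" "j \<noteq> j'"
    from ext[OF j(1)] obtain c0 c where c: "g c0 c j = 0" "\<forall>j'\<in>J - {j}. g c0 c j' > 0" by blast
    obtain a where "\<forall>j. a \<bullet> \<phi> j = (\<Sum>i<d. c i * u i j)" using func by blast
    then have "g c0 c j = g c0 c j'" unfolding g_def using j(3) by metis
    moreover have "g c0 c j' > 0" using c(2) j by blast
    ultimately show False using c(1) by simp
  qed
  let ?P = "\<phi> ` J"
  have cardP: "card ?P = card J" using inj by (rule card_image)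
  have dimU: "dim ?U = d"
    using B independent_mono[OF independent_Basis B(1)] by (simp add: dim_eq_card_independent)
  have extreme: "?P \<subseteq> vertices (convex hull ?P)"
  proof
    fix p assume "p \<in> ?P"
    then obtain j where j: "j \<in> J" "p = \<phi> j" by auto
    from ext[OF j(1)] obtain c0 c where c: "g c0 c j = 0" "\<forall>j'\<in>J - {j}. g c0 c j' > 0" by blast
    obtain a where a: "\<forall>j. a \<bullet> \<phi> j = (\<Sum>i<d. c i * u i j)" using func by blast
    have ge: "a \<bullet> \<phi> j' > - c0" if "j' \<in> J - {j}" for j'
      using c a that unfolding g_def by force
    have eq: "a \<bullet> \<phi> j = - c0" using c a unfolding g_def by force
    \<comment> \<open>All other points lie in an open half-space whose bounding hyperplane contains
      \<open>p\<close>.\<close>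
    have "p \<notin> convex hull (?P - {p})"
    proof
      assume "p \<in> convex hull (?P - {p})"
      moreover have "convex hull (?P - {p}) \<subseteq> {x. a \<bullet> x > - c0}"
        using ge j by (intro hull_minimal) (auto simp: convex_halfspace_gt)
      ultimately show False using eq j by auto
    qed
    then show "p \<in> vertices (convex hull ?P)"
      unfolding vertices_def
      using extreme_point_of_convex_hull_insert[of "?P - {p}" p] J j
      by (auto simp: insert_absorb)
  qed
  interpret general_position ?P ?U d
  proof
    show "?P \<subseteq> ?U"
      unfolding \<phi>_def using bB by (intro image_subsetI span_sum span_scale span_base) auto
  next
    fix a :: 'a and v :: real assume a: "a \<in> ?U" "a \<noteq> 0"
    have "\<exists>i<d. a \<bullet> b i \<noteq> 0"
    proof (rule ccontr)
      assume "\<not> ?thesis"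
      then have "\<And>x. x \<in> B \<Longrightarrow> orthogonal a x"
        using b by (force simp: bij_betw_def orthogonal_def)
      then have "orthogonal a a"
        using a(1) orthogonal_to_span by blast
      then show False using a(2) by (simp add: orthogonal_def)
    qed
    then have "card {j \<in> J. g (- v) (\<lambda>i. a \<bullet> b i) j = 0} \<le> d"
      by (rule gp)
    moreover have "{p \<in> ?P. a \<bullet> p = v} = \<phi> ` {j \<in> J. g (- v) (\<lambda>i. a \<bullet> b i) j = 0}"
      by (auto simp: g_def inner)
    ultimately show "card {p \<in> ?P. a \<bullet> p = v} \<le> d"
      using card_image_le[of "{j \<in> J. g (- v) (\<lambda>i. a \<bullet> b i) j = 0}" \<phi>] J by simp
  qed (use J d dimU cardP extreme in auto)
  have "real m / real (card ?P) \<le> transversal_ratio (boundary_complex (convex hull ?P))"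
  proof (rule transversal_ratio_ge[OF m])
    fix S assume S: "S \<subseteq> ?P" "card S < m"
    let ?S = "{j \<in> J. \<phi> j \<in> S}"
    have "card ?S = card S"
    proof -
      have "\<phi> ` ?S = S" using S(1) by auto
      moreover have "inj_on \<phi> ?S" using inj by (rule inj_on_subset) auto
      ultimately show ?thesis using card_image by metis
    qed
    then obtain D c0 c where D: "D \<subseteq> J" "card D = d" "D \<inter> ?S = {}"
      "\<forall>j\<in>D. g c0 c j = 0" "\<forall>j\<in>J - D. g c0 c j > 0"
      using avoid[of ?S] S(2) by auto
    obtain a where a: "\<forall>j. a \<bullet> \<phi> j = (\<Sum>i<d. c i * u i j)" using func by blast
    have "\<phi> ` D \<in> facets (boundary_complex (convex hull ?P))"
    proof (rule facetI[where a = a and b = "- c0"])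
      show "card (\<phi> ` D) = d"
        using D(1,2) inj by (metis card_image inj_on_subset)
      show "- c0 \<le> a \<bullet> p" if "p \<in> ?P" for p
        using that D(4,5) a unfolding g_def by (cases "p \<in> \<phi> ` D") force+
      show "a \<bullet> p = - c0 \<longleftrightarrow> p \<in> \<phi> ` D" if p: "p \<in> ?P" for p
      proof
        assume eq: "a \<bullet> p = - c0"
        obtain j where "j \<in> J" "p = \<phi> j" using p by auto
        then show "p \<in> \<phi> ` D" using eq a D(5) unfolding g_def by force
      next
        assume "p \<in> \<phi> ` D"
        then show "a \<bullet> p = - c0" using D(4) a unfolding g_def by force
      qed
    qed (use D in auto)
    moreover have "\<phi> ` D \<inter> S = {}" "\<phi> ` D \<noteq> {}" using D d by auto
    ultimately show "\<exists>D\<in>facets (boundary_complex (convex hull ?P)). D \<inter> S = {} \<and> D \<noteq> {}"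
      by blast
  qed
  then show ?thesis
    using simplicial_polytope vertices_hull cardP by metis
qed

section \<open>Points on and above the moment curve\<close>

lemma poly_eq_coordinates:
  fixes L :: "real poly"
  assumes "degree L \<le> n"
  shows "poly L x = coeff L 0 + (\<Sum>i<n. coeff L (Suc i) * x ^ Suc i)"
proof -
  have "poly L x = (\<Sum>i<Suc n. coeff L i * x ^ i)"
    unfolding poly_altdef using assms
    by (intro sum.mono_neutral_left) (auto simp: coeff_eq_0)
  then show ?thesis by (simp add: sum.lessThan_Suc_shift del: sum.lessThan_Suc)
qed

lemma coordinates_eq_poly:
  fixes c0 :: real
  obtains q where "degree q \<le> n" "coeff q 0 = c0" "\<And>i. i < n \<Longrightarrow> coeff q (Suc i) = c i"
    "\<And>x. c0 + (\<Sum>i<n. c i * x ^ Suc i) = poly q x"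
proof
  let ?q = "pCons c0 (\<Sum>i<n. monom (c i) i)"
  show deg: "degree ?q \<le> n"
    by (rule degree_le) (auto simp: coeff_pCons coeff_sum split: nat.split)
  show c: "coeff ?q (Suc i) = c i" if "i < n" for i
    using that by (simp add: coeff_sum)
  show "c0 + (\<Sum>i<n. c i * x ^ Suc i) = poly ?q x" for x
    unfolding poly_eq_coordinates[OF deg] using c by simp
qed simp

text \<open>Newton's scheme: the polynomial for the old nodes is corrected by a multiple of
  \<open>?w\<close>, which vanishes at exactly these nodes.\<close>

lemma interpolation_exists:
  fixes T :: "'j \<Rightarrow> real"
  assumes "finite D" "inj_on T D"
  shows "\<exists>p. degree p \<le> card D - 1 \<and> (\<forall>y\<in>D. poly p (T y) = f y)"
  using assms
proof (induction D)
  case (insert x D)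
  then obtain p where p: "degree p \<le> card D - 1" "\<forall>y\<in>D. poly p (T y) = f y" by auto
  let ?w = "\<Prod>y\<in>D. [:- T y, 1:]"
  let ?p = "p + smult ((f x - poly p (T x)) / poly ?w (T x)) ?w"
  have "poly ?w (T x) \<noteq> 0"
    using insert by (auto simp: poly_prod)
  moreover have "poly ?w (T y) = 0" if "y \<in> D" for y
    using insert(1) that by (auto simp: poly_prod prod_zero_iff)
  moreover have "degree ?w \<le> card D"
    using degree_prod_sum_le[OF insert(1), of "\<lambda>y. [:- T y, 1:]"] by (simp add: o_def)
  then have "degree ?p \<le> card D"
    using p(1) by (intro degree_add_le order.trans[OF degree_smult_le]) auto
  ultimately show ?case
    using insert p by (intro exI[of _ ?p]) auto
qed (auto intro: exI[of _ 0])

lemma card_poly_zeros_le: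
  fixes T :: "'j \<Rightarrow> real"
  assumes "inj_on T J" "finite J" "p \<noteq> 0"
  shows "card {j \<in> J. poly p (T j) = 0} \<le> degree p"
proof -
  have "card {j \<in> J. poly p (T j) = 0} = card (T ` {j \<in> J. poly p (T j) = 0})"
    using assms(1) by (intro card_image[symmetric] inj_on_subset[OF assms(1)]) auto
  also have "\<dots> \<le> card {x. poly p x = 0}"
    using poly_roots_finite[OF assms(3)] by (intro card_mono) auto
  also have "\<dots> \<le> degree p" using assms(3) by (rule card_poly_roots_bound)
  finally show ?thesis .
qed

text \<open>The perturbation by \<open>\<eta> t\<^sup>n\<^sup>+\<^sup>1\<close> shifts all divided differences of order \<open>n + 1\<close> by \<open>\<eta>\<close>.\<close>

lemma finite_degenerate_perturbations:
  fixes T Z :: "'j \<Rightarrow> real"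
  assumes J: "finite J" "inj_on T J"
  shows "finite {\<eta>. \<exists>q. degree q \<le> n \<and>
    n + 1 < card {j \<in> J. poly q (T j) = Z j + \<eta> * T j ^ Suc n}}" (is "finite ?B")
proof -
  \<comment> \<open>The parameters that put all points of \<open>C\<close> on one graph of degree at
    most \<open>n\<close>; there is at most one if \<open>C\<close> has more than
    \<open>n + 1\<close> elements.\<close>
  define E where "E C = {\<eta>. \<exists>q. degree q \<le> n \<and> (\<forall>j\<in>C. poly q (T j) = Z j + \<eta> * T j ^ Suc n)}" for C
  have "finite (E C)" if C: "C \<subseteq> J" "n + 1 < card C" for C
  proof -
    have "a = b" if ab: "a \<in> E C" "b \<in> E C" for a b
    proof (rule ccontr)
      assume "a \<noteq> b"
      obtain p q where pq: "degree p \<le> n" "\<forall>j\<in>C. poly p (T j) = Z j + a * T j ^ Suc n"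
        "degree q \<le> n" "\<forall>j\<in>C. poly q (T j) = Z j + b * T j ^ Suc n"
        using ab by (auto simp: E_def)
      \<comment> \<open>On \<open>C\<close> the two interpolants differ by
        \<open>(a - b) t^(n+1)\<close>, so \<open>?r\<close> has degree \<open>n + 1\<close> but
        more than \<open>n + 1\<close> zeros.\<close>
      let ?r = "p - q - monom (a - b) (Suc n)"
      have "coeff ?r (Suc n) \<noteq> 0" using pq \<open>a \<noteq> b\<close> by (simp add: coeff_eq_0)
      then have nz: "?r \<noteq> 0" by (metis coeff_0)
      have "degree ?r \<le> Suc n"
        using pq by (intro degree_diff_le) (auto intro: degree_monom_le)
      moreover have "{j \<in> C. poly ?r (T j) = 0} = C"
        using pq by (auto simp: poly_monom algebra_simps)
      moreover have "card {j \<in> C. poly ?r (T j) = 0} \<le> degree ?r"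
        using J C nz by (intro card_poly_zeros_le) (auto intro: inj_on_subset finite_subset)
      ultimately show False using C by simp
    qed
    then have "E C \<subseteq> {SOME a. a \<in> E C}"
      by (metis singletonI someI subsetI)
    then show ?thesis by (rule finite_subset) simp
  qed
  then have "finite (\<Union>C\<in>{C \<in> Pow J. n + 1 < card C}. E C)"
    using J by auto
  moreover have "?B \<subseteq> (\<Union>C\<in>{C \<in> Pow J. n + 1 < card C}. E C)"
  proof
    fix \<eta> assume "\<eta> \<in> ?B"
    then obtain q where q: "degree q \<le> n"
      "n + 1 < card {j \<in> J. poly q (T j) = Z j + \<eta> * T j ^ Suc n}" by blast
    then have "\<eta> \<in> E {j \<in> J. poly q (T j) = Z j + \<eta> * T j ^ Suc n}"
      unfolding E_def by blast
    then show "\<eta> \<in> (\<Union>C\<in>{C \<in> Pow J. n + 1 < card C}. E C)"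
      using q(2) by (intro UN_I[where a = "{j \<in> J. poly q (T j) = Z j + \<eta> * T j ^ Suc n}"]) auto
  qed
  ultimately show ?thesis by (rule finite_subset[rotated])
qed

text \<open>For \<open>D\<close> of size \<open>n + 1\<close> this says that \<open>D\<close> spans a supporting hyperplane of the points
  \<open>(t, \<dots>, t\<^sup>n, z)\<close> and contains all points on it.\<close>

definition one_sided :: "nat \<Rightarrow> 'j set \<Rightarrow> ('j \<Rightarrow> real) \<Rightarrow> ('j \<Rightarrow> real) \<Rightarrow> 'j set \<Rightarrow> bool" where
  "one_sided n J T Z D \<longleftrightarrow> (\<exists>L c. degree L \<le> n \<and> (\<forall>j\<in>D. poly L (T j) = Z j) \<and>
     (\<forall>j\<in>J - D. c * (poly L (T j) - Z j) > 0))"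

lemma eventually_gt_0:
  fixes f :: "real \<Rightarrow> real"
  assumes "(f \<longlongrightarrow> l) F" "l > 0"
  shows "\<forall>\<^sub>F x in F. f x > 0"
  using order_tendstoD(1)[OF assms] .

text \<open>If \<open>R\<close> interpolates \<open>t^(n+1)\<close> on \<open>D\<close>, then
  \<open>L + \<eta> R\<close> keeps the equations on \<open>D\<close> exact, and the finitely many
  strict inequalities survive a small \<eta>.\<close>

lemma one_sided_perturb:
  assumes J: "finite J" "inj_on T J" and D: "D \<subseteq> J" "card D = Suc n" "one_sided n J T Z D"
  shows "\<forall>\<^sub>F \<eta> in at_right 0. one_sided n J T (\<lambda>j. Z j + \<eta> * T j ^ Suc n) D"
proof -
  obtain L c where L: "degree L \<le> n" "\<forall>j\<in>D. poly L (T j) = Z j"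
    "\<forall>j\<in>J - D. c * (poly L (T j) - Z j) > 0"
    using D(3) by (auto simp: one_sided_def)
  obtain R where R: "degree R \<le> n" "\<forall>j\<in>D. poly R (T j) = T j ^ Suc n"
    using interpolation_exists[of D T "\<lambda>j. T j ^ Suc n"] J D
    by (auto intro: inj_on_subset finite_subset)
  let ?f = "\<lambda>\<eta> j. c * (poly (L + smult \<eta> R) (T j) - (Z j + \<eta> * T j ^ Suc n))"
  have "\<forall>\<^sub>F \<eta> in at_right 0. ?f \<eta> j > 0" if "j \<in> J - D" for j
  proof (rule eventually_gt_0)
    show "((\<lambda>\<eta>. ?f \<eta> j) \<longlongrightarrow> c * (poly L (T j) + 0 * poly R (T j) - (Z j + 0 * T j ^ Suc n))) (at_right 0)"
      unfolding poly_add poly_smult by (intro tendsto_intros)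
  qed (use L(3) that in simp)
  then have "\<forall>\<^sub>F \<eta> in at_right 0. \<forall>j\<in>J - D. ?f \<eta> j > 0"
    using J by (intro eventually_ball_finite) auto
  then show ?thesis
  proof eventually_elim
    case (elim \<eta>)
    have "degree (L + smult \<eta> R) \<le> n"
      using L R by (intro degree_add_le order.trans[OF degree_smult_le])
    moreover have "\<forall>j\<in>D. poly (L + smult \<eta> R) (T j) = Z j + \<eta> * T j ^ Suc n"
      using L R by simp
    ultimately show ?case using elim unfolding one_sided_def by blast
  qed
qed

text \<open>This functional touches the moment curve at a single point, which makes every point of
  the configuration a vertex.\<close>

lemma square_coordinates:
  fixes s :: real
  assumes "2 \<le> n"
  obtains c0 c where "\<And>x. c0 + (\<Sum>i<n. c i * x ^ Suc i) = (x - s)\<^sup>2"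
proof
  let ?q = "[:s\<^sup>2, - 2 * s, 1:]"
  show "coeff ?q 0 + (\<Sum>i<n. coeff ?q (Suc i) * x ^ Suc i) = (x - s)\<^sup>2" for x
    using assms by (subst poly_eq_coordinates[symmetric]) (auto simp: power2_eq_square algebra_simps)
qed

text \<open>The given heights may be degenerate. Adding a small multiple of \<open>t^(n+1)\<close>
  gives general position, since only finitely many factors are bad, and keeps every one-sided set of
  size \<open>n + 1\<close>.\<close>

lemma exists_simplicial_polytope_lift:
  fixes T Z :: "'j \<Rightarrow> real"
  assumes J: "finite J" "inj_on T J" and dim: "n + 1 \<le> DIM('a::euclidean_space)"
    and n: "2 \<le> n" "n + 1 < card J" and m: "m > 0"
    and avoid: "\<And>S. S \<subseteq> J \<Longrightarrow> card S < m \<Longrightarrow> \<exists>D\<subseteq>J. card D = Suc n \<and> D \<inter> S = {} \<and> one_sided n J T Z D"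
  shows "\<exists>Q :: 'a set. simplicial_polytope (n + 1) Q \<and> card (vertices Q) = card J \<and>
    real m / real (card J) \<le> transversal_ratio (boundary_complex Q)"
proof -
  let ?B = "{\<eta>. \<exists>q. degree q \<le> n \<and> n + 1 < card {j \<in> J. poly q (T j) = Z j + \<eta> * T j ^ Suc n}}"
  have "\<forall>\<^sub>F \<eta> in at_right 0. \<forall>b\<in>?B. \<eta> \<noteq> b"
    by (intro eventually_ball_finite finite_degenerate_perturbations J ballI eventually_neq_at_within)
  moreover have "\<forall>\<^sub>F \<eta> in at_right 0. \<forall>D\<in>{D \<in> Pow J. card D = Suc n \<and> one_sided n J T Z D}.
      one_sided n J T (\<lambda>j. Z j + \<eta> * T j ^ Suc n) D"
    using J by (intro eventually_ball_finite ballI one_sided_perturb) auto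
  ultimately have "\<forall>\<^sub>F \<eta> in at_right (0::real). (\<forall>b\<in>?B. \<eta> \<noteq> b) \<and>
    (\<forall>D\<in>{D \<in> Pow J. card D = Suc n \<and> one_sided n J T Z D}.
      one_sided n J T (\<lambda>j. Z j + \<eta> * T j ^ Suc n) D)"
    by (rule eventually_conj)
  then obtain \<eta> where \<eta>: "\<eta> \<notin> ?B" "\<And>D. D \<subseteq> J \<Longrightarrow> card D = Suc n \<Longrightarrow> one_sided n J T Z D \<Longrightarrow>
      one_sided n J T (\<lambda>j. Z j + \<eta> * T j ^ Suc n) D"
    using eventually_happens'[OF trivial_limit_at_right_real] by blast
  define Y where "Y j = Z j + \<eta> * T j ^ Suc n" for j
  have gpY: "card {j \<in> J. poly q (T j) = Y j} \<le> n + 1" if "degree q \<le> n" for q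
    using \<eta>(1) that unfolding Y_def by (auto simp: not_less)
  define u where "u i j = (if i < n then T j ^ Suc i else Y j)" for i j
  have u: "c0 + (\<Sum>i<n + 1. c i * u i j) = c0 + (\<Sum>i<n. c i * T j ^ Suc i) + c n * Y j" for c0 c j
    by (simp add: u_def)
  show ?thesis
  proof (rule exists_simplicial_polytope[where u = u and J = J and d = "n + 1"])
    fix c0 :: real and c :: "nat \<Rightarrow> real" assume c: "\<exists>i<n + 1. c i \<noteq> 0"
    obtain q where q: "degree q \<le> n" "coeff q 0 = c0" "\<And>i. i < n \<Longrightarrow> coeff q (Suc i) = c i"
      "\<And>x. c0 + (\<Sum>i<n. c i * x ^ Suc i) = poly q x"
      using coordinates_eq_poly[of n c0 c] by blast
    show "card {j \<in> J. c0 + (\<Sum>i<n + 1. c i * u i j) = 0} \<le> n + 1"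
    \<comment> \<open>Without the height coordinate the functional is a nonzero polynomial of degree
      at most \<open>n\<close>; otherwise its zero set is the graph of such a polynomial.\<close>
    proof (cases "c n = 0")
      case True
      then have "\<exists>i<n. coeff q (Suc i) \<noteq> 0" using c q(3) by (auto simp: less_Suc_eq)
      then have "q \<noteq> 0" by auto
      then have "card {j \<in> J. poly q (T j) = 0} \<le> degree q"
        using J by (intro card_poly_zeros_le)
      then show ?thesis using q(1) True unfolding u q(4) by simp
    next
      case False
      then have "{j \<in> J. c0 + (\<Sum>i<n + 1. c i * u i j) = 0}
          = {j \<in> J. poly (smult (- 1 / c n) q) (T j) = Y j}"
        unfolding u q(4) by (auto simp: field_simps)
      then show ?thesis using gpY[of "smult (- 1 / c n) q"] q(1) False by simp
    qed
  next
    fix j assume j: "j \<in> J"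
    obtain c0 c where c: "\<And>x. c0 + (\<Sum>i<n. c i * x ^ Suc i) = (x - T j)\<^sup>2"
      using square_coordinates[OF n(1), of "T j"] by blast
    have "(\<Sum>i<n. (c(n := 0)) i * x ^ Suc i) = (\<Sum>i<n. c i * x ^ Suc i)" for x
      by (intro sum.cong) auto
    then have "c0 + (\<Sum>i<n + 1. (c(n := 0)) i * u i j') = (T j' - T j)\<^sup>2" for j'
      unfolding u using c by simp
    moreover have "T j' \<noteq> T j" if "j' \<in> J - {j}" for j'
      using that j J(2) by (auto simp: inj_on_def)
    ultimately show "\<exists>c0 c. c0 + (\<Sum>i<n + 1. c i * u i j) = 0 \<and>
        (\<forall>j'\<in>J - {j}. c0 + (\<Sum>i<n + 1. c i * u i j') > 0)"
      by (intro exI[of _ c0] exI[of _ "c(n := 0)"]) auto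
  next
    fix S assume S: "S \<subseteq> J" "card S < m"
    obtain D where D: "D \<subseteq> J" "card D = Suc n" "D \<inter> S = {}" "one_sided n J T Y D"
      using avoid[OF S] \<eta>(2) unfolding Y_def by blast
    then obtain L c where L: "degree L \<le> n" "\<forall>j\<in>D. poly L (T j) = Y j"
      "\<forall>j\<in>J - D. c * (poly L (T j) - Y j) > 0"
      by (auto simp: one_sided_def)
    \<comment> \<open>The functional \<open>c * (L(t) - z)\<close>, where the factor
      \<open>c\<close> makes it positive off \<open>D\<close> whichever side the points are
      on.\<close>
    let ?c = "\<lambda>i. if i < n then c * coeff L (Suc i) else - c"
    have "c * coeff L 0 + (\<Sum>i<n + 1. ?c i * u i j) = c * (poly L (T j) - Y j)" for j
      unfolding u poly_eq_coordinates[OF L(1)] by (simp add: algebra_simps sum_distrib_left)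
    then have "(\<forall>j\<in>D. c * coeff L 0 + (\<Sum>i<n + 1. ?c i * u i j) = 0) \<and>
        (\<forall>j\<in>J - D. c * coeff L 0 + (\<Sum>i<n + 1. ?c i * u i j) > 0)"
      using L by simp
    then have "\<exists>c0 c. (\<forall>j\<in>D. c0 + (\<Sum>i<n + 1. c i * u i j) = 0) \<and>
        (\<forall>j\<in>J - D. c0 + (\<Sum>i<n + 1. c i * u i j) > 0)"
      by (intro exI[of _ "c * coeff L 0"] exI[of _ ?c])
    then show "\<exists>D\<subseteq>J. card D = n + 1 \<and> D \<inter> S = {} \<and> (\<exists>c0 c. (\<forall>j\<in>D. c0 + (\<Sum>i<n + 1. c i * u i j) = 0) \<and>
        (\<forall>j\<in>J - D. c0 + (\<Sum>i<n + 1. c i * u i j) > 0))"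
      using D by auto
  qed (use J dim n m in auto)
qed

section \<open>Even dimension: cyclic polytopes\<close>

text \<open>At most \<open>N - k\<close> points touch at most \<open>N - k\<close> of the
  \<open>N\<close> pairs, and \<open>k\<close> untouched pairs form a facet.\<close>

lemma exists_simplicial_polytope_even:
  assumes k: "k \<ge> 1" "k < N" and dim: "2 * k \<le> DIM('a::euclidean_space)"
  shows "\<exists>Q :: 'a set. simplicial_polytope (2 * k) Q \<and> card (vertices Q) = 2 * N \<and>
    real (N - k + 1) / real (2 * N) \<le> transversal_ratio (boundary_complex Q)"
proof -
  let ?J = "{..<2 * N}"
  let ?u = "\<lambda>i j. real j ^ Suc i"
  have "\<exists>Q :: 'a set. simplicial_polytope (2 * k) Q \<and> card (vertices Q) = card ?J \<and>
    real (N - k + 1) / real (card ?J) \<le> transversal_ratio (boundary_complex Q)"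
  proof (rule exists_simplicial_polytope[where u = ?u])
    fix c0 :: real and c :: "nat \<Rightarrow> real" assume c: "\<exists>i<2 * k. c i \<noteq> 0"
    obtain q where q: "degree q \<le> 2 * k" "coeff q 0 = c0" "\<And>i. i < 2 * k \<Longrightarrow> coeff q (Suc i) = c i"
      "\<And>x. c0 + (\<Sum>i<2 * k. c i * x ^ Suc i) = poly q x"
      using coordinates_eq_poly[of "2 * k" c0 c] by blast
    have "q \<noteq> 0" using c q(3) by auto
    then have "card {j \<in> ?J. poly q (real j) = 0} \<le> degree q"
      by (intro card_poly_zeros_le) (auto simp: inj_on_def)
    then show "card {j \<in> ?J. c0 + (\<Sum>i<2 * k. c i * ?u i j) = 0} \<le> 2 * k"
      unfolding q(4) using q(1) by simp
  next
    fix j assume "j \<in> ?J"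
    have "2 \<le> 2 * k" using k by simp
    then obtain c0 c where c: "\<And>x. c0 + (\<Sum>i<2 * k. c i * x ^ Suc i) = (x - real j)\<^sup>2"
      using square_coordinates by blast
    then show "\<exists>c0 c. c0 + (\<Sum>i<2 * k. c i * ?u i j) = 0 \<and>
        (\<forall>j'\<in>?J - {j}. c0 + (\<Sum>i<2 * k. c i * ?u i j') > 0)"
      by (intro exI[of _ c0] exI[of _ c]) auto
  next
    fix S assume S: "S \<subseteq> ?J" "card S < N - k + 1"
    have "finite S" using S(1) finite_subset by blast
    let ?G = "{i \<in> {..<N}. 2 * i \<notin> S \<and> 2 * i + 1 \<notin> S}"
    have "{..<N} - ?G \<subseteq> (\<lambda>s. s div 2) ` S"
      by (auto intro: rev_image_eqI)
    then have "card ({..<N} - ?G) \<le> card S"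
      using \<open>finite S\<close> surj_card_le by blast
    moreover have "card ({..<N} - ?G) = N - card ?G"
      by (subst card_Diff_subset) auto
    ultimately have "k \<le> card ?G" using S(2) k by linarith
    then obtain I where I: "I \<subseteq> ?G" "card I = k" "finite I"
      using obtain_subset_with_card_n by meson
    let ?D = "\<Union>i\<in>I. {2 * i, 2 * i + 1}"
    \<comment> \<open>Positive at all integers outside \<open>?D\<close>, since none lies strictly
      between \<open>2 * i\<close> and \<open>2 * i + 1\<close>.\<close>
    let ?q = "\<Prod>i\<in>I. [:- real (2 * i), 1:] * [:- real (2 * i + 1), 1:]"
    have cD: "card ?D = 2 * k"
      using I by (subst card_UN_disjoint) auto
    have q: "poly ?q x = (\<Prod>i\<in>I. (x - real (2 * i)) * (x - real (2 * i + 1)))" for x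
      by (simp add: poly_prod algebra_simps)
    have "degree ?q \<le> (\<Sum>i\<in>I. 2)"
      by (rule order.trans[OF degree_prod_sum_le[OF I(3)]])
        (auto intro!: sum_mono order.trans[OF degree_mult_le] simp: o_def)
    then have deg: "degree ?q \<le> 2 * k" using I by simp
    have "(\<forall>j\<in>?D. poly ?q (real j) = 0) \<and> (\<forall>j\<in>?J - ?D. poly ?q (real j) > 0)"
    proof (intro conjI ballI)
      show "poly ?q (real j) = 0" if "j \<in> ?D" for j
        unfolding q using that I(3) by (auto simp: prod_zero_iff)
      show "poly ?q (real j) > 0" if j: "j \<in> ?J - ?D" for j
        unfolding q
      proof (rule prod_pos)
        fix i assume "i \<in> I"
        then have "j < 2 * i \<or> 2 * i + 1 < j" using j by auto
        then show "(real j - real (2 * i)) * (real j - real (2 * i + 1)) > 0"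
          by (auto intro: mult_pos_pos mult_neg_neg)
      qed
    qed
    then have "\<exists>c0 c. (\<forall>j\<in>?D. c0 + (\<Sum>i<2 * k. c i * ?u i j) = 0) \<and>
        (\<forall>j\<in>?J - ?D. c0 + (\<Sum>i<2 * k. c i * ?u i j) > 0)"
      unfolding poly_eq_coordinates[OF deg]
      by (intro exI[of _ "coeff ?q 0"] exI[of _ "\<lambda>i. coeff ?q (Suc i)"])
    moreover have "?D \<subseteq> ?J" "?D \<inter> S = {}" using I by auto
    ultimately show "\<exists>D\<subseteq>?J. card D = 2 * k \<and> D \<inter> S = {} \<and> (\<exists>c0 c. (\<forall>j\<in>D. c0 + (\<Sum>i<2 * k. c i * ?u i j) = 0) \<and>
        (\<forall>j\<in>?J - D. c0 + (\<Sum>i<2 * k. c i * ?u i j) > 0))"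
      using cD by (intro exI[of _ ?D]) auto
  qed (use k dim in auto)
  then show ?thesis by simp
qed

section \<open>Blocks of five points\<close>

lemma tendsto_poly:
  fixes p :: "real poly"
  assumes "(f \<longlongrightarrow> l) F"
  shows "((\<lambda>x. poly p (f x)) \<longlongrightarrow> poly p l) F"
  unfolding poly_altdef by (intro tendsto_intros assms)

text \<open>Lagrange's form of the polynomial in \<open>x\<close> of degree at most 2 through
  \<open>(p, u)\<close>, \<open>(q, v)\<close>, \<open>(r, w)\<close>.\<close>

definition lagrange2 :: "real \<Rightarrow> real \<Rightarrow> real \<Rightarrow> real \<Rightarrow> real \<Rightarrow> real \<Rightarrow> real \<Rightarrow> real" where
  "lagrange2 p q r u v w x = u * ((x - q) * (x - r)) / ((p - q) * (p - r))
     - v * ((x - p) * (x - r)) / ((p - q) * (q - r)) + w * ((x - p) * (x - q)) / ((p - r) * (q - r))"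

text \<open>The coefficient of \<open>x^2\<close> in \<open>lagrange2\<close>, that is, the second
  divided difference.\<close>

definition lead2 :: "real \<Rightarrow> real \<Rightarrow> real \<Rightarrow> real \<Rightarrow> real \<Rightarrow> real \<Rightarrow> real" where
  "lead2 p q r u v w = u / ((p - q) * (p - r)) - v / ((p - q) * (q - r)) + w / ((p - r) * (q - r))"

lemma lagrange2_nodes:
  assumes "p \<noteq> q" "p \<noteq> r" "q \<noteq> r"
  shows "lagrange2 p q r u v w p = u" "lagrange2 p q r u v w q = v" "lagrange2 p q r u v w r = w"
proof -
  have "(q - p) * (q - r) = - ((p - q) * (q - r))" "(r - p) * (r - q) = (p - r) * (q - r)"
    by (simp_all add: algebra_simps)
  then show "lagrange2 p q r u v w p = u" "lagrange2 p q r u v w q = v" "lagrange2 p q r u v w r = w"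
    using assms by (simp_all add: lagrange2_def)
qed

text \<open>Interpolation is linear and reproduces constants. It is applied with the values of
  \<open>M\<close> and \<open>W\<close> at \<tau> as \<open>m\<close> and \<open>c\<close>.\<close>

lemma lagrange2_affine:
  assumes "p \<noteq> q" "p \<noteq> r" "q \<noteq> r" "c \<noteq> 0"
  shows "m + c * lagrange2 p q r ((u - m) / c) ((v - m) / c) ((w - m) / c) x = lagrange2 p q r u v w x"
proof -
  have "p - q \<noteq> 0" "p - r \<noteq> 0" "q - r \<noteq> 0" using assms by auto
  then show ?thesis
    using assms(4) unfolding lagrange2_def
    by (simp add: divide_simps) (simp add: algebra_simps)
qed

lemma lead2_affine:
  assumes "p \<noteq> q" "p \<noteq> r" "q \<noteq> r"
  shows "lead2 p q r ((u - m) / c) ((v - m) / c) ((w - m) / c) = lead2 p q r u v w / c"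
proof (cases "c = 0")
  case False
  have "p - q \<noteq> 0" "p - r \<noteq> 0" "q - r \<noteq> 0" using assms by auto
  then show ?thesis
    using False unfolding lead2_def
    by (simp add: divide_simps) (simp add: algebra_simps)
qed (simp add: lead2_def)

lemma poly_lagrange2:
  assumes "\<epsilon> \<noteq> 0"
  obtains H where "degree H \<le> 2" "\<And>x. poly H x = lagrange2 p q r u v w ((x - \<tau>) / \<epsilon>)"
proof
  let ?l = "\<lambda>a. [:- (\<tau> + \<epsilon> * a) / \<epsilon>, 1 / \<epsilon>:]"
  let ?H = "smult (u / ((p - q) * (p - r))) (?l q * ?l r) - smult (v / ((p - q) * (q - r))) (?l p * ?l r)
    + smult (w / ((p - r) * (q - r))) (?l p * ?l q)"
  have deg: "degree (smult c (?l a * ?l b)) \<le> 2" for a b c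
    by (rule order.trans[OF degree_smult_le], rule order.trans[OF degree_mult_le]) simp
  show "degree ?H \<le> 2" by (intro degree_add_le degree_diff_le deg)
  have "poly (?l a) x = (x - \<tau>) / \<epsilon> - a" for a x
    using assms by (simp add: field_simps)
  then show "poly ?H x = lagrange2 p q r u v w ((x - \<tau>) / \<epsilon>)" for x
    unfolding poly_add poly_diff poly_smult poly_mult lagrange2_def by simp
qed

text \<open>As the triple \<open>\<tau> + \<epsilon>p, \<tau> + \<epsilon>q, \<tau> + \<epsilon>r\<close> shrinks, the quadratic correction \<open>H\<close> in \<open>L = M + W H\<close>
  blows up like \<open>\<epsilon>\<^sup>-\<^sup>2\<close> away from \<open>\<tau>\<close>, with the sign of its leading coefficient.\<close>

lemma eventually_block_interpolant:
  fixes M W :: "real poly" and p q r u v w :: real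
  defines "ld \<equiv> lead2 p q r u v w"
  assumes pqr: "p \<noteq> q" "p \<noteq> r" "q \<noteq> r" and W: "poly W \<tau> > 0"
    and S: "finite S" "\<And>a z. (a, z) \<in> S \<Longrightarrow> ld * (lagrange2 p q r u v w a - z) > 0"
    and X: "finite X" "\<And>x z. (x, z) \<in> X \<Longrightarrow> x \<noteq> \<tau> \<and> poly W x > 0" and ld: "ld \<noteq> 0"
    and deg: "degree M \<le> n" "degree W + 2 \<le> n"
  shows "\<forall>\<^sub>F \<epsilon> in at_right 0. \<exists>L. degree L \<le> n \<and>
    poly L (\<tau> + \<epsilon> * p) = u \<and> poly L (\<tau> + \<epsilon> * q) = v \<and> poly L (\<tau> + \<epsilon> * r) = w \<and>
    (\<forall>(a, z)\<in>S. ld * (poly L (\<tau> + \<epsilon> * a) - z) > 0) \<and> (\<forall>(x, z)\<in>X. ld * (poly L x - z) > 0) \<and>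
    (\<forall>x. poly W x = 0 \<longrightarrow> poly L x = poly M x)"
proof -
  let ?F = "at_right (0::real)"
  \<comment> \<open>The value that \<open>H\<close> needs at the rescaled node \<open>s\<close> so
    that \<open>M + W * H\<close> equals \<open>y\<close> there; \<open>V0\<close> is its
    limit.\<close>
  define V where "V s y \<epsilon> = (y - poly M (\<tau> + \<epsilon> * s)) / poly W (\<tau> + \<epsilon> * s)" for s y \<epsilon>
  define V0 where "V0 y = (y - poly M \<tau>) / poly W \<tau>" for y
  have lim: "((\<lambda>\<epsilon>. poly P (\<tau> + \<epsilon> * a)) \<longlongrightarrow> poly P \<tau>) ?F" for P a
    by (rule tendsto_poly) (auto intro!: tendsto_eq_intros)
  have Vlim: "((\<lambda>\<epsilon>. V s y \<epsilon>) \<longlongrightarrow> V0 y) ?F" for s y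
    unfolding V_def V0_def using W by (intro tendsto_intros lim) auto
  have Wpos: "\<forall>\<^sub>F \<epsilon> in ?F. poly W (\<tau> + \<epsilon> * a) > 0" for a
    by (rule eventually_gt_0[OF lim W])
  let ?h = "\<lambda>\<epsilon>. lagrange2 p q r (V p u \<epsilon>) (V q v \<epsilon>) (V r w \<epsilon>)"
  \<comment> \<open>Near \<tau> both \<open>M\<close> and \<open>W\<close> are almost constant, so
    in the rescaled variable \<open>L\<close> tends to the quadratic through the values
    \<open>u\<close>, \<open>v\<close>, \<open>w\<close>.\<close>
  have S': "\<forall>\<^sub>F \<epsilon> in ?F. \<forall>s\<in>S. ld * (poly M (\<tau> + \<epsilon> * fst s) + poly W (\<tau> + \<epsilon> * fst s) * ?h \<epsilon> (fst s) - snd s) > 0"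
  proof (intro eventually_ball_finite S(1) ballI)
    fix s assume s: "s \<in> S"
    obtain a z where az: "s = (a, z)" by (cases s)
    have "((\<lambda>\<epsilon>. ld * (poly M (\<tau> + \<epsilon> * a) + poly W (\<tau> + \<epsilon> * a) * ?h \<epsilon> a - z)) \<longlongrightarrow>
        ld * (poly M \<tau> + poly W \<tau> * lagrange2 p q r (V0 u) (V0 v) (V0 w) a - z)) ?F"
      unfolding lagrange2_def using pqr by (intro tendsto_intros lim Vlim) auto
    moreover have "poly M \<tau> + poly W \<tau> * lagrange2 p q r (V0 u) (V0 v) (V0 w) a = lagrange2 p q r u v w a"
      unfolding V0_def using W pqr by (intro lagrange2_affine) auto
    ultimately have "((\<lambda>\<epsilon>. ld * (poly M (\<tau> + \<epsilon> * a) + poly W (\<tau> + \<epsilon> * a) * ?h \<epsilon> a - z)) \<longlongrightarrow>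
        ld * (lagrange2 p q r u v w a - z)) ?F" by simp
    then show "\<forall>\<^sub>F \<epsilon> in ?F. ld * (poly M (\<tau> + \<epsilon> * fst s) + poly W (\<tau> + \<epsilon> * fst s) * ?h \<epsilon> (fst s) - snd s) > 0"
      unfolding az fst_conv snd_conv using S(2) s az by (intro eventually_gt_0) auto
  qed
  \<comment> \<open>Away from \<tau>, the expression times \<open>\<epsilon>^2\<close> tends to a
    positive multiple of \<open>ld^2\<close>.\<close>
  have X': "\<forall>\<^sub>F \<epsilon> in ?F. \<forall>s\<in>X. ld * (poly M (fst s) + poly W (fst s) * ?h \<epsilon> ((fst s - \<tau>) / \<epsilon>) - snd s) > 0"
  proof (intro eventually_ball_finite X(1) ballI)
    fix s assume s: "s \<in> X"
    obtain x z where xz: "s = (x, z)" by (cases s)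
    have x: "x \<noteq> \<tau>" "poly W x > 0" using X(2) s xz by auto
    let ?g = "\<lambda>\<epsilon>. V p u \<epsilon> * ((x - \<tau> - \<epsilon> * q) * (x - \<tau> - \<epsilon> * r)) / ((p - q) * (p - r))
      - V q v \<epsilon> * ((x - \<tau> - \<epsilon> * p) * (x - \<tau> - \<epsilon> * r)) / ((p - q) * (q - r))
      + V r w \<epsilon> * ((x - \<tau> - \<epsilon> * p) * (x - \<tau> - \<epsilon> * q)) / ((p - r) * (q - r))"
    let ?gl = "V0 u * ((x - \<tau> - 0 * q) * (x - \<tau> - 0 * r)) / ((p - q) * (p - r))
      - V0 v * ((x - \<tau> - 0 * p) * (x - \<tau> - 0 * r)) / ((p - q) * (q - r))
      + V0 w * ((x - \<tau> - 0 * p) * (x - \<tau> - 0 * q)) / ((p - r) * (q - r))"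
    have g0: "?gl = (x - \<tau>)\<^sup>2 * (ld / poly W \<tau>)"
    proof -
      have "?gl = (x - \<tau>)\<^sup>2 * lead2 p q r (V0 u) (V0 v) (V0 w)"
        unfolding lead2_def by (simp add: power2_eq_square algebra_simps)
      then show ?thesis unfolding V0_def ld_def using lead2_affine[OF pqr] by simp
    qed
    have "((\<lambda>\<epsilon>. ld * (\<epsilon>\<^sup>2 * (poly M x - z) + poly W x * ?g \<epsilon>)) \<longlongrightarrow>
        ld * (0\<^sup>2 * (poly M x - z) + poly W x * ?gl)) ?F"
      using pqr by (intro tendsto_intros Vlim) auto
    moreover have "ld * (0\<^sup>2 * (poly M x - z) + poly W x * ?gl) = ld\<^sup>2 * ((x - \<tau>)\<^sup>2 * poly W x / poly W \<tau>)"
      unfolding g0 by (simp add: power2_eq_square)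
    moreover have "ld\<^sup>2 * ((x - \<tau>)\<^sup>2 * poly W x / poly W \<tau>) > 0"
      using x W ld by simp
    ultimately have "\<forall>\<^sub>F \<epsilon> in ?F. ld * (\<epsilon>\<^sup>2 * (poly M x - z) + poly W x * ?g \<epsilon>) > 0"
      by (intro eventually_gt_0) auto
    then show "\<forall>\<^sub>F \<epsilon> in ?F. ld * (poly M (fst s) + poly W (fst s) * ?h \<epsilon> ((fst s - \<tau>) / \<epsilon>) - snd s) > 0"
      using eventually_at_right_less[of 0]
    proof eventually_elim
      case (elim \<epsilon>)
      have sc: "\<epsilon>\<^sup>2 * (y * (((x - \<tau>) / \<epsilon> - b) * ((x - \<tau>) / \<epsilon> - c)) / d) =
          y * ((x - \<tau> - \<epsilon> * b) * (x - \<tau> - \<epsilon> * c)) / d" for y b c d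
      proof -
        have "\<epsilon> * ((x - \<tau>) / \<epsilon> - b) = x - \<tau> - \<epsilon> * b" for b
          using elim(2) by (simp add: field_simps)
        then show ?thesis by (metis (no_types, opaque_lifting) mult.assoc mult.left_commute power2_eq_square times_divide_eq_right)
      qed
      have "y * (b - c + d) = y * b - y * c + y * d" for y b c d :: real
        by (simp add: algebra_simps)
      then have "\<epsilon>\<^sup>2 * ?h \<epsilon> ((x - \<tau>) / \<epsilon>) = ?g \<epsilon>"
        unfolding lagrange2_def by (simp only: sc)
      then have "ld * (\<epsilon>\<^sup>2 * (poly M x - z) + poly W x * ?g \<epsilon>) =
          ld * (\<epsilon>\<^sup>2 * (poly M x - z) + poly W x * (\<epsilon>\<^sup>2 * ?h \<epsilon> ((x - \<tau>) / \<epsilon>)))"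
        by (simp only:)
      also have "\<dots> = \<epsilon>\<^sup>2 * (ld * (poly M x + poly W x * ?h \<epsilon> ((x - \<tau>) / \<epsilon>) - z))"
        by (simp add: algebra_simps)
      finally have "ld * (\<epsilon>\<^sup>2 * (poly M x - z) + poly W x * ?g \<epsilon>) =
          \<epsilon>\<^sup>2 * (ld * (poly M x + poly W x * ?h \<epsilon> ((x - \<tau>) / \<epsilon>) - z))" .
      then have "\<epsilon>\<^sup>2 * (ld * (poly M x + poly W x * ?h \<epsilon> ((x - \<tau>) / \<epsilon>) - z)) > 0"
        using elim(1) by (simp only:)
      moreover have "\<epsilon>\<^sup>2 > 0" using elim(2) by simp
      ultimately show ?case unfolding xz fst_conv snd_conv by (rule zero_less_mult_pos)
    qed
  qed
  from S' X' Wpos[of p] Wpos[of q] Wpos[of r] eventually_at_right_less[of 0]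
  show ?thesis
  proof eventually_elim
    case (elim \<epsilon>)
    obtain H where H: "degree H \<le> 2" "\<And>x. poly H x = ?h \<epsilon> ((x - \<tau>) / \<epsilon>)"
      using poly_lagrange2[of \<epsilon> p q r "V p u \<epsilon>" "V q v \<epsilon>" "V r w \<epsilon>" \<tau>] elim(6) by blast
    \<comment> \<open>The summand \<open>W * H\<close> does not change the values of
      \<open>M\<close> at the zeros of \<open>W\<close>.\<close>
    let ?L = "M + W * H"
    have Ha: "poly H (\<tau> + \<epsilon> * a) = ?h \<epsilon> a" for a
      using elim(6) by (simp add: H(2))
    have "degree ?L \<le> n"
      using deg H(1) degree_mult_le[of W H] by (intro degree_add_le) auto
    moreover have "poly ?L (\<tau> + \<epsilon> * p) = u" "poly ?L (\<tau> + \<epsilon> * q) = v" "poly ?L (\<tau> + \<epsilon> * r) = w"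
      using elim(3,4,5) by (simp_all add: Ha lagrange2_nodes[OF pqr] V_def)
    moreover have "\<forall>(a, z)\<in>S. ld * (poly ?L (\<tau> + \<epsilon> * a) - z) > 0"
      using elim(1) by (auto simp: Ha)
    moreover have "\<forall>(x, z)\<in>X. ld * (poly ?L x - z) > 0"
      using elim(2) by (auto simp: H(2))
    ultimately show ?case by (intro exI[of _ ?L]) auto
  qed
qed

section \<open>The block configuration and its candidate facets\<close>

text \<open>Each block has its own spacing, so that the spacings can be chosen one at a
  time.\<close>

definition block_point :: "(nat \<Rightarrow> real) \<Rightarrow> nat \<times> nat \<Rightarrow> real" where
  "block_point \<epsilon> = (\<lambda>(i, j). real i + \<epsilon> i * real j)"

definition block_height :: "nat \<times> nat \<Rightarrow> real" where
  "block_height = (\<lambda>(i, j). if j < 2 then 0 else if j = 2 then 2 else 1)"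

text \<open>Three of the four lower facets of the points \<open>(j, j\<^sup>2, z)\<close>, where \<open>z\<close> is the block height of \<open>j\<close>.
  Lower is meant with respect to \<open>j\<^sup>2\<close>, so the sign of the coefficient of \<open>z\<close> varies.\<close>

definition block_triples :: "nat set set" where
  "block_triples = {{0, 1, 2}, {1, 3, 4}, {2, 3, 4}}"

text \<open>The triple sits in the block of largest index because that block is opened last, when
  the scales of the blocks with pairs are already fixed.\<close>

definition block_facets :: "nat \<Rightarrow> nat \<Rightarrow> (nat \<times> nat) set set" where
  "block_facets h m = {({i} \<times> A) \<union> (\<Union>l\<in>I. {l} \<times> {f l, Suc (f l)}) |i A I f.
     i < m \<and> A \<in> block_triples \<and> I \<subseteq> {..<i} \<and> card I = h \<and> (\<forall>l\<in>I. f l < 4)}"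

text \<open>This is why one point per block is not enough for a transversal.\<close>

lemma block_triple_avoiding:
  "\<exists>A\<in>block_triples. s \<notin> A"
  unfolding block_triples_def by (cases "s = 2") auto

lemma less_5_cases: "(j::nat) < 5 \<longleftrightarrow> j = 0 \<or> j = 1 \<or> j = 2 \<or> j = 3 \<or> j = 4"
  by auto

text \<open>By computation: the leading coefficients are \<open>1\<close>, \<open>-1/6\<close> and
  \<open>1/2\<close>, so the inequality is reversed for \<open>{1, 3, 4}\<close> only.\<close>

lemma block_triple_lower:
  fixes i :: nat
  assumes "A \<in> block_triples"
  obtains p q r where "A = {p, q, r}" "p < q" "q < r" "r < 5"
    "lead2 p q r (block_height (i, p)) (block_height (i, q)) (block_height (i, r)) \<noteq> 0"
    "\<And>j. j < 5 \<Longrightarrow> j \<notin> A \<Longrightarrow>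
       lead2 p q r (block_height (i, p)) (block_height (i, q)) (block_height (i, r)) *
       (lagrange2 p q r (block_height (i, p)) (block_height (i, q)) (block_height (i, r)) j - block_height (i, j)) > 0"
proof -
  consider "A = {0, 1, 2}" | "A = {1, 3, 4}" | "A = {2, 3, 4}"
    using assms by (auto simp: block_triples_def)
  then show thesis
  proof cases
    case 1
    show thesis
      by (rule that[of 0 1 2])
        (auto simp: 1 less_5_cases lead2_def lagrange2_def block_height_def)
  next
    case 2
    show thesis
      by (rule that[of 1 3 4])
        (auto simp: 2 less_5_cases lead2_def lagrange2_def block_height_def)
  next
    case 3
    show thesis
      by (rule that[of 2 3 4])
        (auto simp: 3 less_5_cases lead2_def lagrange2_def block_height_def)
  qed
qed

lemma card_block_triple: "A \<in> block_triples \<Longrightarrow> finite A \<and> card A = 3 \<and> A \<subseteq> {..<5}"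
  by (auto simp: block_triples_def)

lemma card_block_pairs:
  assumes "finite I"
  shows "card (\<Union>l\<in>I. {l} \<times> {f l, Suc (f l)}) = 2 * card I"
proof -
  have "card (\<Union>l\<in>I. {l} \<times> {f l, Suc (f l)}) = (\<Sum>l\<in>I. card ({l} \<times> {f l, Suc (f l)}))"
    using assms by (intro card_UN_disjoint) auto
  then show ?thesis by simp
qed

lemma block_facets_props:
  assumes "D \<in> block_facets h m"
  shows "D \<subseteq> {..<m} \<times> {..<5}" and "card D = 2 * h + 3"
proof -
  obtain i A I f where D: "D = ({i} \<times> A) \<union> (\<Union>l\<in>I. {l} \<times> {f l, Suc (f l)})"
    "i < m" "A \<in> block_triples" "I \<subseteq> {..<i}" "card I = h" "\<forall>l\<in>I. f l < 4"
    using assms unfolding block_facets_def by blast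
  note A = card_block_triple[OF D(3)]
  have "finite I" using D(4) finite_subset by blast
  show "D \<subseteq> {..<m} \<times> {..<5}" using D A by fastforce
  have "card D = card ({i} \<times> A) + card (\<Union>l\<in>I. {l} \<times> {f l, Suc (f l)})"
    unfolding D(1) using A D(4) \<open>finite I\<close> by (intro card_Un_disjoint) auto
  then show "card D = 2 * h + 3"
    using card_block_pairs[OF \<open>finite I\<close>, of f] A D(5) by (simp add: card_cartesian_product_singleton)
qed

section \<open>Opening the blocks one by one\<close>

lemma block_point_bounds:
  assumes "0 \<le> \<epsilon> i" "\<epsilon> i < 1 / 5" "j < 5"
  shows "real i \<le> block_point \<epsilon> (i, j)" "block_point \<epsilon> (i, j) < real i + 1"
proof -
  have "\<epsilon> i * real j \<le> \<epsilon> i * 4" using assms by (intro mult_left_mono) auto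
  then show "real i \<le> block_point \<epsilon> (i, j)" "block_point \<epsilon> (i, j) < real i + 1"
    using assms by (auto simp: block_point_def)
qed

lemma block_point_less:
  assumes "\<And>i. 0 \<le> \<epsilon> i \<and> \<epsilon> i < 1 / 5" "j < 5" "j' < 5" "i < i'"
  shows "block_point \<epsilon> (i, j) < block_point \<epsilon> (i', j')"
proof -
  have "real i + 1 \<le> real i'" using assms(4) by simp
  then show ?thesis
    using block_point_bounds[of \<epsilon> i j] block_point_bounds[of \<epsilon> i' j'] assms by fastforce
qed

lemma inj_on_block_point:
  assumes "\<And>i. 0 \<le> \<epsilon> i \<and> \<epsilon> i < 1 / 5" "\<And>i. i < m \<Longrightarrow> \<epsilon> i > 0"
  shows "inj_on (block_point \<epsilon>) ({..<m} \<times> {..<5})"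
proof (rule inj_onI)
  fix x y assume xy: "x \<in> {..<m} \<times> {..<5}" "y \<in> {..<m} \<times> {..<5}" "block_point \<epsilon> x = block_point \<epsilon> y"
  obtain i j i' j' where ij: "x = (i, j)" "y = (i', j')" by (cases x, cases y)
  have "i = i'"
    using block_point_less[of \<epsilon> j j' i i', OF assms(1)] block_point_less[of \<epsilon> j' j i' i, OF assms(1)] xy ij
    by (cases i i' rule: linorder_cases) auto
  then show "x = y" using xy ij assms(2)[of i] by (auto simp: block_point_def)
qed

text \<open>The same \<open>L\<close> works: points of \<open>D\<close> stay fixed, and the others
  only have to satisfy strict inequalities.\<close>

lemma one_sided_moving:
  assumes "finite J" "one_sided n J T Z D" "\<And>e j. j \<in> D \<Longrightarrow> T' e j = T j"
    and lim: "\<And>j. j \<in> J \<Longrightarrow> ((\<lambda>e. T' e j) \<longlongrightarrow> T j) F"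
  shows "\<forall>\<^sub>F e in F. one_sided n J (T' e) Z D"
proof -
  obtain L c where L: "degree L \<le> n" "\<forall>j\<in>D. poly L (T j) = Z j"
    "\<forall>j\<in>J - D. c * (poly L (T j) - Z j) > 0"
    using assms(2) by (auto simp: one_sided_def)
  have "\<forall>\<^sub>F e in F. c * (poly L (T' e j) - Z j) > 0" if "j \<in> J - D" for j
    using that L(3)
    by (intro order_tendstoD(1)[where y = "c * (poly L (T j) - Z j)"] tendsto_intros tendsto_poly lim) auto
  then have "\<forall>\<^sub>F e in F. \<forall>j\<in>J - D. c * (poly L (T' e j) - Z j) > 0"
    using assms(1) by (intro eventually_ball_finite) auto
  then show ?thesis
  proof eventually_elim
    case (elim e)
    then show ?case unfolding one_sided_def using L assms(3) by (intro exI[of _ L] exI[of _ c]) auto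
  qed
qed

text \<open>The block interpolant is used at \<open>m\<close>, with \<open>M\<close> prescribing the
  heights on the pairs and \<open>W\<close> vanishing there. \<open>W\<close> is positive at all
  other points because each pair is adjacent within its block.\<close>

lemma eventually_one_sided_new_block:
  assumes \<epsilon>: "\<And>i. 0 \<le> \<epsilon> i \<and> \<epsilon> i < 1 / 5" "\<And>i. i < m \<Longrightarrow> \<epsilon> i > 0"
    and A: "A \<in> block_triples" and I: "I \<subseteq> {..<m}" "card I = h" and f: "\<forall>l\<in>I. f l < 4"
  shows "\<forall>\<^sub>F e in at_right 0. one_sided (2 * h + 2) ({..<N} \<times> {..<5}) (block_point (\<epsilon>(m := e))) block_height
    ({m} \<times> A \<union> (\<Union>l\<in>I. {l} \<times> {f l, Suc (f l)}))"
proof -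
  let ?J = "{..<N} \<times> {..<5::nat}"
  define D where "D = (\<Union>l\<in>I. {l} \<times> {f l, Suc (f l)})"
  let ?T = "block_point \<epsilon>"
  have finI: "finite I" using I(1) finite_subset by blast
  have cD: "card D = 2 * h" "finite D"
    unfolding D_def using card_block_pairs[OF finI, of f] I(2) finI by auto
  have Dsub: "D \<subseteq> {..<m} \<times> {..<5}" unfolding D_def using I(1) f by fastforce
  \<comment> \<open>For \<open>h = 0\<close> the truncated difference is \<open>0\<close> and
    \<open>M\<close> is constant.\<close>
  obtain M where M: "degree M \<le> 2 * h - 1" "\<forall>y\<in>D. poly M (?T y) = block_height y"
    using interpolation_exists[of D ?T block_height] cD inj_on_subset[OF inj_on_block_point[of \<epsilon> m, OF \<epsilon>] Dsub]
    by auto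
  define W where "W = (\<Prod>l\<in>I. [:- ?T (l, f l), 1:] * [:- ?T (l, Suc (f l)), 1:])"
  have W: "poly W x = (\<Prod>l\<in>I. (x - ?T (l, f l)) * (x - ?T (l, Suc (f l))))" for x
    by (simp add: W_def poly_prod algebra_simps)
  have "degree W \<le> (\<Sum>l\<in>I. 2)"
    unfolding W_def by (rule order.trans[OF degree_prod_sum_le[OF finI]])
      (auto intro!: sum_mono order.trans[OF degree_mult_le] simp: o_def)
  then have degW: "degree W + 2 \<le> 2 * h + 2" using I(2) by simp
  have W0: "poly W (?T y) = 0" if "y \<in> D" for y
    unfolding W using that finI by (auto simp: D_def prod_zero_iff)
  have Wpos: "poly W (?T (i, j)) > 0" if ij: "j < 5" "(i, j) \<notin> D" for i j
    unfolding W
  proof (rule prod_pos)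
    fix l assume l: "l \<in> I"
    then have fl: "f l < 5" "Suc (f l) < 5" "l < m" using f I(1) by auto
    have "(?T (i, j) < ?T (l, f l) \<and> ?T (i, j) < ?T (l, Suc (f l))) \<or>
      (?T (i, j) > ?T (l, f l) \<and> ?T (i, j) > ?T (l, Suc (f l)))"
    proof (cases i l rule: linorder_cases)
      case equal
      then have "j < f l \<or> Suc (f l) < j" using ij(2) l by (auto simp: D_def)
      then show ?thesis
        unfolding equal using \<epsilon>(2)[OF fl(3)] by (auto simp: block_point_def)
    qed (use block_point_less[of \<epsilon>, OF \<epsilon>(1)] ij(1) fl in auto)
    then show "(?T (i, j) - ?T (l, f l)) * (?T (i, j) - ?T (l, Suc (f l))) > 0"
      by (auto intro: mult_pos_pos mult_neg_neg)
  qed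
  have "(m, 0) \<notin> D" using Dsub by auto
  from Wpos[OF _ this] have Wm: "poly W (real m) > 0" by (simp add: block_point_def)
  obtain p q r where pqr: "A = {p, q, r}" "p < q" "q < r" "r < 5"
    and ld: "lead2 p q r (block_height (m, p)) (block_height (m, q)) (block_height (m, r)) \<noteq> 0"
    and low: "\<And>j. j < 5 \<Longrightarrow> j \<notin> A \<Longrightarrow>
       lead2 p q r (block_height (m, p)) (block_height (m, q)) (block_height (m, r)) *
       (lagrange2 p q r (block_height (m, p)) (block_height (m, q)) (block_height (m, r)) j - block_height (m, j)) > 0"
    using block_triple_lower[OF A, of m] by blast
  let ?ld = "lead2 p q r (block_height (m, p)) (block_height (m, q)) (block_height (m, r))"
  \<comment> \<open>The points off the facet: \<open>?S\<close> holds those of block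
    \<open>m\<close> in rescaled coordinates, \<open>?X\<close> those of all other blocks.\<close>
  let ?S = "(\<lambda>j. (real j, block_height (m, j))) ` ({..<5} - A)"
  let ?X = "(\<lambda>y. (?T y, block_height y)) ` {y \<in> ?J - D. fst y \<noteq> m}"
  have "\<forall>\<^sub>F e in at_right 0. \<exists>L. degree L \<le> 2 * h + 2 \<and>
    poly L (real m + e * real p) = block_height (m, p) \<and> poly L (real m + e * real q) = block_height (m, q) \<and>
    poly L (real m + e * real r) = block_height (m, r) \<and>
    (\<forall>(a, z)\<in>?S. ?ld * (poly L (real m + e * a) - z) > 0) \<and> (\<forall>(x, z)\<in>?X. ?ld * (poly L x - z) > 0) \<and>
    (\<forall>x. poly W x = 0 \<longrightarrow> poly L x = poly M x)"
  proof (rule eventually_block_interpolant)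
    fix x z assume "(x, z) \<in> ?X"
    then obtain i j where ij: "(i, j) \<in> ?J - D" "i \<noteq> m" "x = ?T (i, j)" by auto
    have "x \<noteq> ?T (m, 0)"
      using ij block_point_less[of \<epsilon> j 0 i m, OF \<epsilon>(1)] block_point_less[of \<epsilon> 0 j m i, OF \<epsilon>(1)]
      by (cases i m rule: linorder_cases) auto
    then show "x \<noteq> real m \<and> poly W x > 0" using Wpos[of j i] ij by (auto simp: block_point_def)
  qed (use pqr ld low Wm degW M(1) in auto)
  then show ?thesis
  proof eventually_elim
    case (elim e)
    then obtain L where L: "degree L \<le> 2 * h + 2"
      "poly L (real m + e * real p) = block_height (m, p)" "poly L (real m + e * real q) = block_height (m, q)"
      "poly L (real m + e * real r) = block_height (m, r)"
      and LS: "\<forall>(a, z)\<in>?S. ?ld * (poly L (real m + e * a) - z) > 0"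
      and LX: "\<forall>(x, z)\<in>?X. ?ld * (poly L x - z) > 0"
      and LW: "\<forall>x. poly W x = 0 \<longrightarrow> poly L x = poly M x" by blast
    let ?T' = "block_point (\<epsilon>(m := e))"
    have T'm: "?T' (m, j) = real m + e * real j" for j by (simp add: block_point_def)
    have T': "?T' y = ?T y" if "fst y \<noteq> m" for y
      using that by (cases y) (simp add: block_point_def)
    have "poly L (?T' y) = block_height y" if "y \<in> {m} \<times> A \<union> D" for y
    proof (cases "y \<in> D")
      case True
      then have "fst y \<noteq> m" using Dsub by auto
      then show ?thesis using LW W0[OF True] M(2) True by (simp add: T')
    next
      case False
      then show ?thesis using that L pqr(1) T'm by auto
    qed
    moreover have "?ld * (poly L (?T' y) - block_height y) > 0" if y: "y \<in> ?J - ({m} \<times> A \<union> D)" for y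
    proof (cases "fst y = m")
      case True
      then obtain j where j: "y = (m, j)" by (cases y) auto
      then have "j \<in> {..<5} - A" using y by auto
      then show ?thesis using LS j T'm by auto
    next
      case False
      then have "(?T y, block_height y) \<in> ?X" using y by blast
      then show ?thesis using LX T'[OF False] by fastforce
    qed
    ultimately show ?case
      unfolding one_sided_def D_def[symmetric] using L(1)
      by (intro exI[of _ L] exI[of _ ?ld]) blast
  qed
qed

text \<open>The scales are chosen one after the other. A block with scale \<open>0\<close> is still collapsed to a point,
  and opening it slightly does not affect the supporting hyperplanes found before.\<close>

lemma exists_block_scales:
  "m \<le> N \<Longrightarrow> \<exists>\<epsilon>. (\<forall>i. 0 \<le> \<epsilon> i \<and> \<epsilon> i < 1 / 5) \<and> (\<forall>i<m. \<epsilon> i > 0) \<and> (\<forall>i\<ge>m. \<epsilon> i = 0) \<and>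
    (\<forall>D\<in>block_facets h m. one_sided (2 * h + 2) ({..<N} \<times> {..<5}) (block_point \<epsilon>) block_height D)"
proof (induction m)
  case 0
  show ?case by (intro exI[of _ "\<lambda>_. 0"]) (auto simp: block_facets_def)
next
  case (Suc m)
  then have "m \<le> N" by simp
  from Suc.IH[OF this] obtain \<epsilon> where \<epsilon>: "\<forall>i. 0 \<le> \<epsilon> i \<and> \<epsilon> i < 1 / 5" "\<forall>i<m. \<epsilon> i > 0" "\<forall>i\<ge>m. \<epsilon> i = 0"
    and old: "\<forall>D\<in>block_facets h m. one_sided (2 * h + 2) ({..<N} \<times> {..<5}) (block_point \<epsilon>) block_height D"
    by (elim exE conjE) (rule that)
  let ?P = "\<lambda>e D. one_sided (2 * h + 2) ({..<N} \<times> {..<5}) (block_point (\<epsilon>(m := e))) block_height D"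
  have ev: "\<forall>\<^sub>F e in at_right 0. ?P e D" if D: "D \<in> block_facets h (Suc m)" for D
  proof (cases "D \<in> block_facets h m")
    case True
    \<comment> \<open>\<open>D\<close> has no point in block \<open>m\<close>, so opening that block
      moves only points off the hyperplane.\<close>
    show ?thesis
    proof (rule one_sided_moving[OF _ bspec[OF old True]])
      show "block_point (\<epsilon>(m := e)) y = block_point \<epsilon> y" if "y \<in> D" for e y
        using that block_facets_props(1)[OF True] by (auto simp: block_point_def)
      show "((\<lambda>e. block_point (\<epsilon>(m := e)) y) \<longlongrightarrow> block_point \<epsilon> y) (at_right 0)" for y
      proof -
        have "((\<lambda>e. real (fst y) + (\<epsilon>(m := e)) (fst y) * real (snd y)) \<longlongrightarrow>
            real (fst y) + \<epsilon> (fst y) * real (snd y)) (at_right 0)"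
          using \<epsilon>(3) by (cases "fst y = m") (auto intro!: tendsto_eq_intros)
        then show ?thesis by (simp add: block_point_def case_prod_beta)
      qed
    qed auto
  next
    case False
    obtain i A I f where *: "D = ({i} \<times> A) \<union> (\<Union>l\<in>I. {l} \<times> {f l, Suc (f l)})"
      "i < Suc m" "A \<in> block_triples" "I \<subseteq> {..<i}" "card I = h" "\<forall>l\<in>I. f l < 4"
      using D unfolding block_facets_def by blast
    have "i = m"
    proof (rule ccontr)
      assume "i \<noteq> m"
      then have "i < m" using *(2) by simp
      then have "D \<in> block_facets h m" unfolding block_facets_def using * by blast
      then show False using False by simp
    qed
    then show ?thesis
      using eventually_one_sided_new_block[of \<epsilon> m A I h f N] \<epsilon> * by simp
  qed
  have "finite (block_facets h (Suc m))"
    by (rule finite_subset[of _ "Pow ({..<Suc m} \<times> {..<5})"]) (use block_facets_props(1) in auto)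
  with ev have "\<forall>\<^sub>F e in at_right 0. \<forall>D\<in>block_facets h (Suc m). ?P e D"
    by (intro eventually_ball_finite) auto
  moreover have "\<forall>\<^sub>F e in at_right 0. (e::real) < 1 / 5"
    by (rule order_tendstoD(2)[of "\<lambda>x. x" 0]) auto
  ultimately have "\<forall>\<^sub>F e in at_right 0. (\<forall>D\<in>block_facets h (Suc m). ?P e D) \<and> e < 1 / 5 \<and> (0::real) < e"
    using eventually_at_right_less[of 0] by eventually_elim auto
  then obtain e where e: "\<forall>D\<in>block_facets h (Suc m). ?P e D" "e < 1 / 5" "0 < e"
    using eventually_happens'[OF trivial_limit_at_right_real] by blast
  show ?case
    by (intro exI[of _ "\<epsilon>(m := e)"] conjI e(1)) (use \<epsilon> e in \<open>auto simp: less_Suc_eq\<close>)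
qed

section \<open>Odd dimension: lifted blocks\<close>

text \<open>Fewer than \<open>2 * (N - k + 1)\<close> points put two or more into at most
  \<open>N - k\<close> blocks. Among \<open>k\<close> remaining blocks, one supplies a triple and
  the others pairs that avoid \<open>S\<close>.\<close>

lemma exists_simplicial_polytope_odd:
  assumes k: "k \<ge> 1" "k < N" and dim: "2 * k + 1 \<le> DIM('a::euclidean_space)"
  shows "\<exists>Q :: 'a set. simplicial_polytope (2 * k + 1) Q \<and> card (vertices Q) = 5 * N \<and>
    real (2 * (N - k + 1)) / real (5 * N) \<le> transversal_ratio (boundary_complex Q)"
proof -
  let ?J = "{..<N} \<times> {..<5::nat}"
  obtain h where h: "k = Suc h" using k(1) by (cases k) auto
  obtain \<epsilon> where \<epsilon>: "\<forall>i. 0 \<le> \<epsilon> i \<and> \<epsilon> i < 1 / 5" "\<forall>i<N. \<epsilon> i > 0"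
    and sided: "\<forall>D\<in>block_facets h N. one_sided (2 * h + 2) ?J (block_point \<epsilon>) block_height D"
    using exists_block_scales[OF order_refl, of N h] by (elim exE conjE) (rule that)
  have "\<exists>Q :: 'a set. simplicial_polytope (2 * k + 1) Q \<and> card (vertices Q) = card ?J \<and>
    real (2 * (N - k + 1)) / real (card ?J) \<le> transversal_ratio (boundary_complex Q)"
  proof (rule exists_simplicial_polytope_lift[where T = "block_point \<epsilon>" and Z = block_height])
    show "inj_on (block_point \<epsilon>) ?J" using inj_on_block_point[of \<epsilon> N] \<epsilon> by blast
    fix S assume S: "S \<subseteq> ?J" "card S < 2 * (N - k + 1)"
    let ?s = "\<lambda>i. {j. (i, j) \<in> S}"
    have fins: "finite (?s i)" for i
      by (rule finite_subset[of _ "{..<5}"]) (use S(1) in auto)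
    let ?G = "{i \<in> {..<N}. card (?s i) \<le> 1}"
    have "2 * card ({..<N} - ?G) = (\<Sum>i\<in>{..<N} - ?G. 2)" by simp
    also have "\<dots> \<le> (\<Sum>i\<in>{..<N} - ?G. card (?s i))"
      by (intro sum_mono) auto
    also have "\<dots> \<le> (\<Sum>i<N. card (?s i))"
      by (intro sum_mono2) auto
    also have "\<dots> = card (Sigma {..<N} ?s)"
      using fins by (intro card_SigmaI[symmetric]) auto
    also have "Sigma {..<N} ?s = S" using S(1) by auto
    finally have "2 * card ({..<N} - ?G) < 2 * (N - k + 1)" using S(2) by (rule le_less_trans)
    then have "card ({..<N} - ?G) < N - k + 1" by (rule iffD1[OF nat_mult_less_cancel1[OF zero_less_numeral]])
    moreover have "card ({..<N} - ?G) = N - card ?G"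
      by (subst card_Diff_subset) auto
    ultimately have "k \<le> card ?G" using k by linarith
    then obtain K where K: "K \<subseteq> ?G" "card K = k" "finite K"
      using obtain_subset_with_card_n by meson
    then have "K \<noteq> {}" using k by auto
    \<comment> \<open>\<open>block_facets\<close> requires the triple in the last of the chosen
      blocks.\<close>
    define i where "i = Max K"
    have i: "i \<in> K" unfolding i_def using K \<open>K \<noteq> {}\<close> by simp
    let ?I = "K - {i}"
    have I: "?I \<subseteq> {..<i}" "card ?I = h"
      using K i h by (auto simp: i_def less_le)
    have single: "\<exists>a. ?s l \<subseteq> {a}" if "l \<in> K" for l
    proof -
      have "card (?s l) \<le> Suc 0" using that K(1) by auto
      then have "\<forall>x\<in>?s l. \<forall>y\<in>?s l. x = y"
        using card_le_Suc0_iff_eq[OF fins] by blast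
      then show ?thesis by blast
    qed
    obtain A where A: "A \<in> block_triples" "A \<inter> ?s i = {}"
    proof -
      obtain a where "?s i \<subseteq> {a}" using single[OF i] by blast
      moreover obtain A where "A \<in> block_triples" "a \<notin> A" using block_triple_avoiding by blast
      ultimately show thesis using that by blast
    qed
    have "\<forall>l\<in>?I. \<exists>b<4. (l, b) \<notin> S \<and> (l, Suc b) \<notin> S"
    proof
      fix l assume "l \<in> ?I"
      then obtain a where a: "?s l \<subseteq> {a}" using single by blast
      \<comment> \<open>One of the disjoint pairs \<open>{0, 1}\<close> and \<open>{2, 3}\<close>
        misses \<open>a\<close>.\<close>
      define b :: nat where "b = (if a \<le> 1 then 2 else 0)"
      have "b < 4" "b \<noteq> a" "Suc b \<noteq> a" by (auto simp: b_def)
      then show "\<exists>b<4. (l, b) \<notin> S \<and> (l, Suc b) \<notin> S" using a by blast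
    qed
    then obtain f where f: "\<And>l. l \<in> ?I \<Longrightarrow> f l < 4 \<and> (l, f l) \<notin> S \<and> (l, Suc (f l)) \<notin> S"
      by metis
    let ?D = "{i} \<times> A \<union> (\<Union>l\<in>?I. {l} \<times> {f l, Suc (f l)})"
    have "i < N" using i K(1) by auto
    then have D: "?D \<in> block_facets h N"
      unfolding block_facets_def using A(1) I f by blast
    have n: "2 * k = 2 * h + 2" using h by simp
    have "card ?D = Suc (2 * h + 2)" using block_facets_props(2)[OF D] by simp
    moreover have "?D \<inter> S = {}" using A(2) f by auto
    ultimately show "\<exists>D\<subseteq>?J. card D = Suc (2 * k) \<and> D \<inter> S = {} \<and>
        one_sided (2 * k) ?J (block_point \<epsilon>) block_height D"
      unfolding n by (intro exI[of _ ?D] conjI block_facets_props(1)[OF D] bspec[OF sided D])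
  qed (use k dim in auto)
  then show ?thesis by (simp add: mult.commute)
qed

theorem theorem4p12:
  fixes k :: nat
  assumes "k \<ge> 2"
  shows "(2 * k \<le> DIM('a::euclidean_space) \<longrightarrow>
            tau_P TYPE('a) (2 * k) \<ge> ereal (1 / 2)) \<and>
         (2 * k + 1 \<le> DIM('a) \<longrightarrow>
            tau_P TYPE('a) (2 * k + 1) \<ge> ereal (2 / 5))"
proof (intro conjI impI)
  assume dim: "2 * k \<le> DIM('a)"
  show "tau_P TYPE('a) (2 * k) \<ge> ereal (1 / 2)"
  \<comment> \<open>The construction needs \<open>k < N\<close>, hence
    \<open>l = k + 1\<close>.\<close>
  proof (rule tau_P_ge[where n = "\<lambda>N. 2 * N" and r = "\<lambda>N. real (N - k + 1) / real (2 * N)" and l = "k + 1"])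
    show "strict_mono (\<lambda>N::nat. 2 * N)" by (auto simp: strict_mono_def)
    have "(\<lambda>N. (real N - real k + 1) / (2 * real N)) \<longlonglongrightarrow> 1 / 2"
      by real_asymp
    \<comment> \<open>Natural and real subtraction agree from \<open>N = k\<close> on.\<close>
    then show "(\<lambda>N. real (N - k + 1) / real (2 * N)) \<longlonglongrightarrow> 1 / 2"
      by (rule Lim_transform_eventually)
        (auto intro!: eventually_sequentiallyI[of k] simp: of_nat_diff)
  qed (use exists_simplicial_polytope_even[OF _ _ dim] assms in auto)
next
  assume dim: "2 * k + 1 \<le> DIM('a)"
  show "tau_P TYPE('a) (2 * k + 1) \<ge> ereal (2 / 5)"
  proof (rule tau_P_ge[where n = "\<lambda>N. 5 * N" and r = "\<lambda>N. real (2 * (N - k + 1)) / real (5 * N)" and l = "k + 1"])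
    show "strict_mono (\<lambda>N::nat. 5 * N)" by (auto simp: strict_mono_def)
    have "(\<lambda>N. 2 * (real N - real k + 1) / (5 * real N)) \<longlonglongrightarrow> 2 / 5"
      by real_asymp
    then show "(\<lambda>N. real (2 * (N - k + 1)) / real (5 * N)) \<longlonglongrightarrow> 2 / 5"
      by (rule Lim_transform_eventually)
        (auto intro!: eventually_sequentiallyI[of k] simp: of_nat_diff)
  qed (use exists_simplicial_polytope_odd[OF _ _ dim] assms in auto)
qed

end
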